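(* The Hilbert space compression of any hyperbolic group $G$ is equal to $1$, i.e. $R(G)=1$.
   Context: Let $(X,d_X)$ be a metric space and $\mathcal{H}$ a Hilbert space, with $d_{\mathcal{H}}$ the metric given by the norm. A map $f\colon X\to\mathcal{H}$ is a uniform embedding if there exist non-decreasing functions $\rho,\delta\colon\mathbb{R}_+\to\mathbb{R}_+$ such that (1) $\rho(d_X(x,y))\le d_{\mathcal{H}}(f(x),f(y))\le\delta(d_X(x,y))$ for all $x,y\in X$, and (2) $\lim_{t\to+\infty}\rho(t)=+\infty$. The compression of $f$ is the function $\rho_f(t)=\inf\{d_{\mathcal{H}}(f(x),f(y)) \mid d_X(x,y)\ge t\}$ (with $\inf\emptyset=+\infty$). For functions $g,h$ of a positive real variable (defined for all sufficiently large $t$), $g\preceq h$ (equivalently $h\succeq g$) means that there exist numbers $C>0$ and $M$ such that $g(t)\le C\,h(t)$ for all $t\ge M$. Finitely generated groups are viewed as metric spaces with the word length metric of a finite generating set. The Hilbert space compression $R(G)$ of a finitely generated group $G$ is the supremum of all numbers $\alpha\in[0,1]$ for which there exists a uniform embedding $f\colon G\to\mathcal{H}$ into a Hilbert space with $\rho_f(t)\succeq t^{\alpha}$. A geodesic triangle in a metric space is $\delta$-thin if each of its sides is contained in the $\delta$-neighborhood of the union of the other two sides. A geodesic metric space is hyperbolic if there exists $\delta>0$ such that every geodesic triangle in it is $\delta$-thin. A finitely generated group is hyperbolic if its Cayley graph with respect to a finite generating set (with edges of length $1$ and the path metric, extending the word metric) is hyperbolic. *)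

theory Defs
  imports "HOL-Analysis.Analysis" "HOL-Algebra.Generated_Groups"
begin

section \<open>The Hilbert space of square-summable sequences\<close>

typedef ell2 = "{x :: nat \<Rightarrow> real. summable (\<lambda>n. (x n)\<^sup>2)}"
  morphisms ell2_nth Abs_ell2
  by (rule exI[of _ "\<lambda>_. 0"]) simp

setup_lifting type_definition_ell2

lemma summable_ell2_mult:
  fixes x y :: "nat \<Rightarrow> real"
  assumes "summable (\<lambda>n. (x n)\<^sup>2)" "summable (\<lambda>n. (y n)\<^sup>2)"
  shows "summable (\<lambda>n. x n * y n)"
proof (rule summable_comparison_test')
  show "summable (\<lambda>n. (x n)\<^sup>2 + (y n)\<^sup>2)"
    using assms by (rule summable_add)
  fix n :: nat
  have "0 \<le> (\<bar>x n\<bar> - \<bar>y n\<bar>)\<^sup>2" by simp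
  then have "2 * (\<bar>x n\<bar> * \<bar>y n\<bar>) \<le> (x n)\<^sup>2 + (y n)\<^sup>2"
    by (simp add: power2_diff)
  moreover have "0 \<le> \<bar>x n\<bar> * \<bar>y n\<bar>" by simp
  ultimately show "norm (x n * y n) \<le> (x n)\<^sup>2 + (y n)\<^sup>2"
    unfolding real_norm_def abs_mult by linarith
qed

lemma summable_ell2_add:
  fixes x y :: "nat \<Rightarrow> real"
  assumes "summable (\<lambda>n. (x n)\<^sup>2)" "summable (\<lambda>n. (y n)\<^sup>2)"
  shows "summable (\<lambda>n. (x n + y n)\<^sup>2)"
  using summable_add[OF summable_add[OF assms]
      summable_mult[OF summable_ell2_mult[OF assms], of 2]]
  by (simp add: power2_sum mult.assoc)

instantiation ell2 :: real_vector
begin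

lift_definition zero_ell2 :: ell2 is "\<lambda>_. 0" by simp

lift_definition plus_ell2 :: "ell2 \<Rightarrow> ell2 \<Rightarrow> ell2" is "\<lambda>x y n. x n + y n"
  by (rule summable_ell2_add)

lift_definition uminus_ell2 :: "ell2 \<Rightarrow> ell2" is "\<lambda>x n. - x n" by simp

lift_definition minus_ell2 :: "ell2 \<Rightarrow> ell2 \<Rightarrow> ell2" is "\<lambda>x y n. x n - y n"
proof -
  fix x y :: "nat \<Rightarrow> real"
  assume "summable (\<lambda>n. (x n)\<^sup>2)" "summable (\<lambda>n. (y n)\<^sup>2)"
  then show "summable (\<lambda>n. (x n - y n)\<^sup>2)"
    using summable_ell2_add[of x "\<lambda>n. - y n"] by simp
qed

lift_definition scaleR_ell2 :: "real \<Rightarrow> ell2 \<Rightarrow> ell2" is "\<lambda>r x n. r * x n"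
  by (simp add: power_mult_distrib summable_mult)

instance
proof
  fix x y z :: ell2 and r s :: real
  show "x + y + z = x + (y + z)" by transfer (simp add: add.assoc)
  show "x + y = y + x" by transfer (simp add: add.commute)
  show "0 + x = x" by transfer simp
  show "- x + x = 0" by transfer simp
  show "x - y = x + - y" by transfer simp
  show "r *\<^sub>R (x + y) = r *\<^sub>R x + r *\<^sub>R y" by transfer (simp add: distrib_left)
  show "(r + s) *\<^sub>R x = r *\<^sub>R x + s *\<^sub>R x" by transfer (simp add: distrib_right)
  show "r *\<^sub>R s *\<^sub>R x = (r * s) *\<^sub>R x" by transfer (simp add: mult.assoc)
  show "1 *\<^sub>R x = x" by transfer simp
qed

end

instantiation ell2 :: real_inner
begin

lift_definition inner_ell2 :: "ell2 \<Rightarrow> ell2 \<Rightarrow> real" is "\<lambda>x y. \<Sum>n. x n * y n" .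

definition norm_ell2 :: "ell2 \<Rightarrow> real" where
  "norm_ell2 x = sqrt (inner x x)"

definition dist_ell2 :: "ell2 \<Rightarrow> ell2 \<Rightarrow> real" where
  "dist_ell2 x y = norm (x - y)"

definition sgn_ell2 :: "ell2 \<Rightarrow> ell2" where
  "sgn_ell2 x = x /\<^sub>R norm x"

definition uniformity_ell2 :: "(ell2 \<times> ell2) filter" where
  "uniformity_ell2 = (INF e\<in>{0<..}. principal {(x, y). dist x y < e})"

definition open_ell2 :: "ell2 set \<Rightarrow> bool" where
  "open_ell2 U \<longleftrightarrow> (\<forall>x\<in>U. \<forall>\<^sub>F (x', y) in uniformity. x' = x \<longrightarrow> y \<in> U)"

instance
proof
  fix x y z :: ell2 and r :: real
  show "sgn x = x /\<^sub>R norm x" by (rule sgn_ell2_def)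
  show "dist x y = norm (x - y)" by (rule dist_ell2_def)
  show "uniformity = (INF e\<in>{0<..}. principal {(x, y :: ell2). dist x y < e})"
    by (rule uniformity_ell2_def)
  show "open U \<longleftrightarrow> (\<forall>x\<in>U. \<forall>\<^sub>F (x', y) in uniformity. x' = x \<longrightarrow> y \<in> U)" for U :: "ell2 set"
    by (rule open_ell2_def)
  show "inner x y = inner y x"
    by transfer (simp add: mult.commute)
  show "inner (x + y) z = inner x z + inner y z"
    by transfer (simp add: distrib_right suminf_add summable_ell2_mult)
  show "inner (r *\<^sub>R x) y = r * inner x y"
    by transfer (simp add: mult.assoc suminf_mult summable_ell2_mult)
  show "0 \<le> inner x x"
    by transfer (simp add: suminf_nonneg summable_ell2_mult)
  show "inner x x = 0 \<longleftrightarrow> x = 0"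
  proof transfer
    fix x :: "nat \<Rightarrow> real"
    assume s: "summable (\<lambda>n. (x n)\<^sup>2)"
    show "(\<Sum>n. x n * x n) = 0 \<longleftrightarrow> x = (\<lambda>_. 0)"
      using suminf_eq_zero_iff[of "\<lambda>n. x n * x n"] summable_ell2_mult[OF s s]
      by (auto simp: fun_eq_iff)
  qed
  show "norm x = sqrt (inner x x)" by (rule norm_ell2_def)
qed

end

lemma norm_ell2_square: "(norm x)\<^sup>2 = (\<Sum>n. (ell2_nth x n)\<^sup>2)"
proof -
  have "(norm x)\<^sup>2 = inner x x" by (rule power2_norm_eq_inner)
  then show ?thesis by (simp add: inner_ell2.rep_eq power2_eq_square)
qed

lemma summable_ell2_nth: "summable (\<lambda>n. (ell2_nth x n)\<^sup>2)"
  using ell2_nth[of x] by simp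

lemma sum_ell2_nth_le: "(\<Sum>n<N. (ell2_nth x n)\<^sup>2) \<le> (norm x)\<^sup>2"
  unfolding norm_ell2_square by (rule sum_le_suminf[OF summable_ell2_nth]) auto

lemma abs_ell2_nth_le: "\<bar>ell2_nth x n\<bar> \<le> norm x"
proof -
  have "(ell2_nth x n)\<^sup>2 \<le> (\<Sum>k<Suc n. (ell2_nth x k)\<^sup>2)"
    by (rule member_le_sum) auto
  also have "\<dots> \<le> (norm x)\<^sup>2" by (rule sum_ell2_nth_le)
  finally show ?thesis
    by (metis abs_le_square_iff abs_norm_cancel)
qed

instance ell2 :: complete_space
proof
  fix X :: "nat \<Rightarrow> ell2"
  assume cauchy: "Cauchy X"
  have "Cauchy (\<lambda>m. ell2_nth (X m) n)" for n
  proof (rule metric_CauchyI)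
    fix e :: real
    assume "0 < e"
    then obtain M where M: "\<forall>m\<ge>M. \<forall>k\<ge>M. dist (X m) (X k) < e"
      using metric_CauchyD[OF cauchy] by blast
    have "dist (ell2_nth (X m) n) (ell2_nth (X k) n) \<le> dist (X m) (X k)" for m k
      using abs_ell2_nth_le[of "X m - X k" n]
      by (simp add: dist_norm minus_ell2.rep_eq)
    with M show "\<exists>M. \<forall>m\<ge>M. \<forall>k\<ge>M. dist (ell2_nth (X m) n) (ell2_nth (X k) n) < e"
      by (meson le_less_trans)
  qed
  then have "\<forall>n. \<exists>l. (\<lambda>m. ell2_nth (X m) n) \<longlonglongrightarrow> l"
    using Cauchy_convergent convergent_def by blast
  then obtain L where L: "\<And>n. (\<lambda>m. ell2_nth (X m) n) \<longlonglongrightarrow> L n"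
    by metis
  have tail: "\<exists>M. \<forall>m\<ge>M. \<forall>N. (\<Sum>n<N. (ell2_nth (X m) n - L n)\<^sup>2) \<le> e\<^sup>2" if e: "0 < e" for e :: real
  proof -
    obtain M where M: "\<forall>m\<ge>M. \<forall>k\<ge>M. dist (X m) (X k) < e"
      using metric_CauchyD[OF cauchy e] by blast
    have "(\<Sum>n<N. (ell2_nth (X m) n - L n)\<^sup>2) \<le> e\<^sup>2" if m: "m \<ge> M" for m N
    proof (rule LIMSEQ_le_const2)
      show "(\<lambda>k. \<Sum>n<N. (ell2_nth (X m) n - ell2_nth (X k) n)\<^sup>2)
              \<longlonglongrightarrow> (\<Sum>n<N. (ell2_nth (X m) n - L n)\<^sup>2)"
        by (intro tendsto_sum tendsto_power tendsto_diff tendsto_const L)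
      have "(\<Sum>n<N. (ell2_nth (X m) n - ell2_nth (X k) n)\<^sup>2) \<le> e\<^sup>2" if "k \<ge> M" for k
      proof -
        have "(\<Sum>n<N. (ell2_nth (X m) n - ell2_nth (X k) n)\<^sup>2) \<le> (norm (X m - X k))\<^sup>2"
          using sum_ell2_nth_le[of "X m - X k" N] by (simp add: minus_ell2.rep_eq)
        also have "\<dots> \<le> e\<^sup>2"
          using M m that by (intro power_mono) (auto simp: dist_norm less_imp_le)
        finally show ?thesis .
      qed
      then show "\<exists>K. \<forall>k\<ge>K. (\<Sum>n<N. (ell2_nth (X m) n - ell2_nth (X k) n)\<^sup>2) \<le> e\<^sup>2"
        by blast
    qed
    then show ?thesis by blast
  qed
  have summable_diff: "summable (\<lambda>n. (ell2_nth (X m) n - L n)\<^sup>2)"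
    if "\<forall>N. (\<Sum>n<N. (ell2_nth (X m) n - L n)\<^sup>2) \<le> c" for m c
    using that by (intro summableI_nonneg_bounded[where x = c]) auto
  obtain M1 where "\<forall>m\<ge>M1. \<forall>N. (\<Sum>n<N. (ell2_nth (X m) n - L n)\<^sup>2) \<le> 1\<^sup>2"
    using tail[of 1] by auto
  then have s1: "summable (\<lambda>n. (ell2_nth (X M1) n - L n)\<^sup>2)"
    by (intro summable_diff[of M1 "1\<^sup>2"]) auto
  have "(L n - ell2_nth (X M1) n)\<^sup>2 = (ell2_nth (X M1) n - L n)\<^sup>2" for n
    by (rule power2_commute)
  with s1 have "summable (\<lambda>n. (L n - ell2_nth (X M1) n)\<^sup>2)" by simp
  from summable_ell2_add[OF summable_ell2_nth[of "X M1"] this] have sL: "summable (\<lambda>n. (L n)\<^sup>2)" by simp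
  define l where "l = Abs_ell2 L"
  have l: "ell2_nth l = L"
    unfolding l_def using sL by (simp add: Abs_ell2_inverse)
  have "X \<longlonglongrightarrow> l"
  proof (rule metric_LIMSEQ_I)
    fix e :: real
    assume "0 < e"
    then obtain M where M: "\<forall>m\<ge>M. \<forall>N. (\<Sum>n<N. (ell2_nth (X m) n - L n)\<^sup>2) \<le> (e/2)\<^sup>2"
      using tail[of "e/2"] by auto
    have "dist (X m) l < e" if "m \<ge> M" for m
    proof -
      have b: "\<forall>N. (\<Sum>n<N. (ell2_nth (X m) n - L n)\<^sup>2) \<le> (e/2)\<^sup>2"
        using M that by blast
      have "(norm (X m - l))\<^sup>2 = (\<Sum>n. (ell2_nth (X m) n - L n)\<^sup>2)"
        by (simp add: norm_ell2_square minus_ell2.rep_eq l)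
      also have "\<dots> \<le> (e/2)\<^sup>2"
        using summable_diff[OF b] b by (intro suminf_le_const) auto
      finally have "norm (X m - l) \<le> e/2"
        by (rule power2_le_imp_le) (use \<open>0 < e\<close> in simp)
      then show ?thesis using \<open>0 < e\<close> by (simp add: dist_norm)
    qed
    then show "\<exists>M. \<forall>m\<ge>M. dist (X m) l < e" by blast
  qed
  then show "convergent X" by (rule convergentI)
qed


section \<open>Uniform embeddings and Hilbert space compression\<close>

definition uniform_embedding ::
    "'a set \<Rightarrow> ('a \<Rightarrow> 'a \<Rightarrow> real) \<Rightarrow> ('a \<Rightarrow> 'h::metric_space) \<Rightarrow> bool" where
  "uniform_embedding X d f \<longleftrightarrow>
     (\<exists>\<rho> \<delta> :: real \<Rightarrow> real.
        \<rho> \<in> {0..} \<rightarrow> {0..} \<and> \<delta> \<in> {0..} \<rightarrow> {0..} \<and>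
        mono_on {0..} \<rho> \<and> mono_on {0..} \<delta> \<and>
        (\<forall>x\<in>X. \<forall>y\<in>X. \<rho> (d x y) \<le> dist (f x) (f y) \<and> dist (f x) (f y) \<le> \<delta> (d x y)) \<and>
        filterlim \<rho> at_top at_top)"

text \<open>The values are extended nonnegative reals so that the infimum of the empty set is
  \<open>\<infinity>\<close>.\<close>

definition compression ::
    "'a set \<Rightarrow> ('a \<Rightarrow> 'a \<Rightarrow> real) \<Rightarrow> ('a \<Rightarrow> 'h::metric_space) \<Rightarrow> real \<Rightarrow> ennreal" where
  "compression X d f t = Inf {ennreal (dist (f x) (f y)) | x y. x \<in> X \<and> y \<in> X \<and> d x y \<ge> t}"

definition asymp_le :: "(real \<Rightarrow> ennreal) \<Rightarrow> (real \<Rightarrow> ennreal) \<Rightarrow> bool"  (infix \<open>\<preceq>\<close> 50) where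
  "g \<preceq> h \<longleftrightarrow> (\<exists>C>0. \<exists>M. \<forall>t\<ge>M. g t \<le> ennreal C * h t)"

definition compression_exponent ::
    "'a set \<Rightarrow> ('a \<Rightarrow> 'a \<Rightarrow> real) \<Rightarrow> 'h::{real_inner, complete_space} itself \<Rightarrow> real \<Rightarrow> bool" where
  "compression_exponent X d H \<alpha> \<longleftrightarrow>
     (\<exists>f :: 'a \<Rightarrow> 'h. uniform_embedding X d f \<and> (\<lambda>t. ennreal (t powr \<alpha>)) \<preceq> compression X d f)"

text \<open>One cannot quantify over all types inside a definition, so the target is fixed to be the
  separable Hilbert space \<open>ell2\<close>. For countable \<open>X\<close>, in particular for finitely generated
  groups, this loses nothing: by \<open>compression_exponent_ell2\<close> below, an exponent achieved in any
  Hilbert space is achieved in \<open>ell2\<close>. Complex Hilbert spaces are covered, being real ones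
  under the real part of the inner product.\<close>

definition hilbert_compression :: "'a set \<Rightarrow> ('a \<Rightarrow> 'a \<Rightarrow> real) \<Rightarrow> ennreal" where
  "hilbert_compression X d =
     Sup {ennreal \<alpha> | \<alpha>. 0 \<le> \<alpha> \<and> \<alpha> \<le> 1 \<and> compression_exponent X d TYPE(ell2) \<alpha>}"

text \<open>Gram--Schmidt; since \<open>sgn 0 = 0\<close>, linearly dependent vectors contribute zero.\<close>

fun gram_schmidt :: "(nat \<Rightarrow> 'h::real_inner) \<Rightarrow> nat \<Rightarrow> 'h" where
  "gram_schmidt v n = sgn (v n - (\<Sum>i<n. inner (v n) (gram_schmidt v i) *\<^sub>R gram_schmidt v i))"

declare gram_schmidt.simps [simp del]

lemma gram_schmidt_self:
  "inner (gram_schmidt v n) (gram_schmidt v n) = (if gram_schmidt v n = 0 then 0 else 1)"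
proof -
  have "norm (gram_schmidt v n) = (if gram_schmidt v n = 0 then 0 else 1)"
    by (subst (1 2) gram_schmidt.simps) (simp add: norm_sgn sgn_zero_iff)
  then show ?thesis
    by (simp add: dot_square_norm split: if_splits)
qed

lemma gram_schmidt_orthogonal: "i < j \<Longrightarrow> inner (gram_schmidt v j) (gram_schmidt v i) = 0"
proof (induction j arbitrary: i rule: less_induct)
  case (less j)
  let ?e = "gram_schmidt v"
  have orth: "inner (?e k) (?e i) = 0" if "k < j" "k \<noteq> i" for k
    using that less.IH[of k i] less.IH[of i k] less.prems inner_commute[of "?e k" "?e i"]
    by (cases "k < i") auto
  have "inner (\<Sum>k<j. inner (v j) (?e k) *\<^sub>R ?e k) (?e i)
      = (\<Sum>k<j. if k = i then inner (v j) (?e i) * inner (?e i) (?e i) else 0)"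
    unfolding inner_sum_left by (rule sum.cong) (auto simp: orth)
  also have "\<dots> = inner (v j) (?e i)"
    using less.prems by (simp add: gram_schmidt_self)
  finally show ?case
    by (subst gram_schmidt.simps) (simp add: sgn_div_norm inner_diff_left)
qed

lemma gram_schmidt_expand: "v n = (\<Sum>i<Suc n. inner (v n) (gram_schmidt v i) *\<^sub>R gram_schmidt v i)"
proof -
  let ?e = "gram_schmidt v"
  define p where "p = (\<Sum>i<n. inner (v n) (?e i) *\<^sub>R ?e i)"
  define r where "r = v n - p"
  have e: "?e n = sgn r"
    unfolding r_def p_def by (rule gram_schmidt.simps)
  have "inner p (?e n) = 0"
    unfolding p_def inner_sum_left
    by (rule sum.neutral) (auto simp: inner_commute[of _ "?e n"] gram_schmidt_orthogonal)
  then have "inner (v n) (?e n) = inner r (?e n)"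
    by (simp add: r_def inner_diff_left)
  also have "\<dots> = norm r"
    by (cases "r = 0") (simp_all add: e sgn_div_norm dot_square_norm power2_eq_square)
  finally have "inner (v n) (?e n) *\<^sub>R ?e n = r"
    by (cases "r = 0") (simp_all add: e sgn_div_norm)
  then show ?thesis
    by (simp add: p_def[symmetric] r_def)
qed

lemma gram_schmidt_coeff_zero:
  assumes "n < m"
  shows "inner (v n) (gram_schmidt v m) = 0"
proof -
  have "inner (\<Sum>i<Suc n. inner (v n) (gram_schmidt v i) *\<^sub>R gram_schmidt v i) (gram_schmidt v m) = 0"
    unfolding inner_sum_left
    by (rule sum.neutral)
      (use assms in \<open>auto simp: inner_commute[of _ "gram_schmidt v m"] gram_schmidt_orthogonal\<close>)
  then show ?thesis
    using gram_schmidt_expand[of v n] by simp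
qed

lemma countable_isometry_into_ell2:
  fixes f :: "'a \<Rightarrow> 'h::real_inner"
  assumes "countable X"
  shows "\<exists>g :: 'a \<Rightarrow> ell2. \<forall>x\<in>X. \<forall>y\<in>X. dist (g x) (g y) = dist (f x) (f y)"
proof -
  define v where "v n = f (from_nat_into X n)" for n
  let ?e = "gram_schmidt v"
  let ?c = "\<lambda>n i. inner (v n) (?e i)"
  define u where "u n = Abs_ell2 (?c n)" for n
  have "summable (\<lambda>i. (?c n i)\<^sup>2)" for n
    by (rule summable_finite[of "{..n}"]) (auto simp: gram_schmidt_coeff_zero)
  then have u: "ell2_nth (u n) = ?c n" for n
    unfolding u_def by (simp add: Abs_ell2_inverse)
  have "dist (u n) (u m) = dist (v n) (v m)" for n m
  proof -
    define N where "N = Suc (max n m)"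
    have expand: "v k = (\<Sum>i<N. ?c k i *\<^sub>R ?e i)" if "k < N" for k
    proof -
      have "(\<Sum>i<N. ?c k i *\<^sub>R ?e i) = (\<Sum>i<Suc k. ?c k i *\<^sub>R ?e i)"
        using that by (intro sum.mono_neutral_right) (auto simp: gram_schmidt_coeff_zero)
      then show ?thesis
        using gram_schmidt_expand[of v k] by simp
    qed
    define w where "w i = ?c n i - ?c m i" for i
    have diff: "v n - v m = (\<Sum>i<N. w i *\<^sub>R ?e i)"
      using expand[of n] expand[of m]
      by (simp add: N_def w_def scaleR_diff_left sum_subtractf)
    have "inner (v n - v m) (v n - v m) = (\<Sum>i<N. w i * inner (v n - v m) (?e i))"
      by (subst (2) diff) (simp add: inner_sum_right)
    also have "\<dots> = (\<Sum>i<N. (w i)\<^sup>2)"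
      by (simp add: w_def inner_diff_left power2_eq_square)
    also have "\<dots> = (\<Sum>i. (w i)\<^sup>2)"
      by (rule suminf_finite[symmetric]) (auto simp: w_def N_def gram_schmidt_coeff_zero)
    also have "\<dots> = (norm (u n - u m))\<^sup>2"
      by (simp add: norm_ell2_square minus_ell2.rep_eq u w_def)
    finally show ?thesis
      by (simp add: dist_norm dot_square_norm)
  qed
  then have "dist (u (to_nat_on X x)) (u (to_nat_on X y)) = dist (f x) (f y)"
    if "x \<in> X" "y \<in> X" for x y
    using that assms by (simp add: v_def)
  then show ?thesis
    by (intro exI[of _ "\<lambda>x. u (to_nat_on X x)"]) blast
qed

lemma compression_exponent_ell2:
  assumes "countable X" and "compression_exponent X d TYPE('h::{real_inner, complete_space}) \<alpha>"
  shows "compression_exponent X d TYPE(ell2) \<alpha>"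
proof -
  obtain f :: "'a \<Rightarrow> 'h" where f: "uniform_embedding X d f"
      "(\<lambda>t. ennreal (t powr \<alpha>)) \<preceq> compression X d f"
    using assms(2) unfolding compression_exponent_def by blast
  obtain g :: "'a \<Rightarrow> ell2" where g: "\<forall>x\<in>X. \<forall>y\<in>X. dist (g x) (g y) = dist (f x) (f y)"
    using countable_isometry_into_ell2[OF assms(1)] by blast
  have "compression X d g t = compression X d f t" for t
    unfolding compression_def
    by (rule arg_cong[where f = Inf], rule Collect_cong) (metis g)
  then have "compression X d g = compression X d f" by blast
  moreover have "uniform_embedding X d g"
    using f(1) g unfolding uniform_embedding_def by simp
  ultimately show ?thesis
    using f(2) unfolding compression_exponent_def by metis
qed


section \<open>Geodesics and hyperbolic metric spaces\<close>

definition geodesic_segment ::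
    "'a set \<Rightarrow> ('a \<Rightarrow> 'a \<Rightarrow> real) \<Rightarrow> 'a \<Rightarrow> 'a \<Rightarrow> 'a set \<Rightarrow> bool" where
  "geodesic_segment X d x y A \<longleftrightarrow>
     (\<exists>(L::real) c. 0 \<le> L \<and> c \<in> {0..L} \<rightarrow> X \<and> c 0 = x \<and> c L = y \<and> A = c ` {0..L} \<and>
        (\<forall>s\<in>{0..L}. \<forall>t\<in>{0..L}. d (c s) (c t) = \<bar>s - t\<bar>))"

definition geodesic_metric_space :: "'a set \<Rightarrow> ('a \<Rightarrow> 'a \<Rightarrow> real) \<Rightarrow> bool" where
  "geodesic_metric_space X d \<longleftrightarrow>
     Metric_space X d \<and> (\<forall>x\<in>X. \<forall>y\<in>X. \<exists>A. geodesic_segment X d x y A)"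

definition geodesic_triangle ::
    "'a set \<Rightarrow> ('a \<Rightarrow> 'a \<Rightarrow> real) \<Rightarrow> 'a set \<Rightarrow> 'a set \<Rightarrow> 'a set \<Rightarrow> bool" where
  "geodesic_triangle X d A B C \<longleftrightarrow>
     (\<exists>x\<in>X. \<exists>y\<in>X. \<exists>z\<in>X.
        geodesic_segment X d x y A \<and> geodesic_segment X d y z B \<and> geodesic_segment X d z x C)"

definition nbhd :: "'a set \<Rightarrow> ('a \<Rightarrow> 'a \<Rightarrow> real) \<Rightarrow> real \<Rightarrow> 'a set \<Rightarrow> 'a set" where
  "nbhd X d \<delta> A = {x \<in> X. \<exists>a\<in>A. d x a < \<delta>}"

definition thin_triangle ::
    "'a set \<Rightarrow> ('a \<Rightarrow> 'a \<Rightarrow> real) \<Rightarrow> real \<Rightarrow> 'a set \<Rightarrow> 'a set \<Rightarrow> 'a set \<Rightarrow> bool" where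
  "thin_triangle X d \<delta> A B C \<longleftrightarrow>
     A \<subseteq> nbhd X d \<delta> (B \<union> C) \<and> B \<subseteq> nbhd X d \<delta> (C \<union> A) \<and> C \<subseteq> nbhd X d \<delta> (A \<union> B)"

definition hyperbolic_space :: "'a set \<Rightarrow> ('a \<Rightarrow> 'a \<Rightarrow> real) \<Rightarrow> bool" where
  "hyperbolic_space X d \<longleftrightarrow>
     geodesic_metric_space X d \<and>
     (\<exists>\<delta>>0. \<forall>A B C. geodesic_triangle X d A B C \<longrightarrow> thin_triangle X d \<delta> A B C)"


section \<open>Graphs as metric spaces with edges of length one\<close>

text \<open>A simple graph is given by a vertex set \<open>V\<close> and a symmetric irreflexive adjacency
  relation \<open>E\<close> on it. A point of its geometric realization is represented by its barycentric
  coordinates, a function on vertices supported on a vertex or on the two ends of an edge;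
  \<open>edge_point u v t\<close> is the point at distance \<open>t\<close> from \<open>u\<close> on the edge from \<open>u\<close> to \<open>v\<close>,
  and \<open>edge_point u u t\<close> is the vertex \<open>u\<close>.\<close>

definition edge_point :: "'a \<Rightarrow> 'a \<Rightarrow> real \<Rightarrow> 'a \<Rightarrow> real" where
  "edge_point u v t = (\<lambda>w. (1 - t) * indicator {u} w + t * indicator {v} w)"

definition realization :: "'a set \<Rightarrow> ('a \<Rightarrow> 'a \<Rightarrow> bool) \<Rightarrow> ('a \<Rightarrow> real) set" where
  "realization V E =
     {edge_point u v t | u v t. u \<in> V \<and> v \<in> V \<and> (u = v \<or> E u v) \<and> 0 \<le> t \<and> t \<le> 1}"

text \<open>Lengths of piecewise linear paths.\<close>

inductive has_path_of_length ::
    "'a set \<Rightarrow> ('a \<Rightarrow> 'a \<Rightarrow> bool) \<Rightarrow> ('a \<Rightarrow> real) \<Rightarrow> ('a \<Rightarrow> real) \<Rightarrow> real \<Rightarrow> bool"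
  for V :: "'a set" and E :: "'a \<Rightarrow> 'a \<Rightarrow> bool" where
  refl: "p \<in> realization V E \<Longrightarrow> has_path_of_length V E p p 0"
| step: "has_path_of_length V E p (edge_point u v s) l \<Longrightarrow> u \<in> V \<Longrightarrow> v \<in> V \<Longrightarrow> E u v \<Longrightarrow>
         s \<in> {0..1} \<Longrightarrow> t \<in> {0..1} \<Longrightarrow> has_path_of_length V E p (edge_point u v t) (l + \<bar>s - t\<bar>)"

text \<open>The value \<open>0\<close> outside the realization is only there because \<^locale>\<open>Metric_space\<close>
  demands nonnegativity and symmetry on the whole type.\<close>

definition path_metric ::
    "'a set \<Rightarrow> ('a \<Rightarrow> 'a \<Rightarrow> bool) \<Rightarrow> ('a \<Rightarrow> real) \<Rightarrow> ('a \<Rightarrow> real) \<Rightarrow> real" where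
  "path_metric V E p q =
     (if p \<in> realization V E \<and> q \<in> realization V E
      then Inf {l. has_path_of_length V E p q l} else 0)"


section \<open>Finitely generated groups\<close>

definition finite_generating_set :: "('a, 'b) monoid_scheme \<Rightarrow> 'a set \<Rightarrow> bool" where
  "finite_generating_set G S \<longleftrightarrow> finite S \<and> S \<subseteq> carrier G \<and> generate G S = carrier G"

definition word_length :: "('a, 'b) monoid_scheme \<Rightarrow> 'a set \<Rightarrow> 'a \<Rightarrow> nat" where
  "word_length G S g =
     (LEAST n. \<exists>ws. length ws = n \<and> set ws \<subseteq> S \<union> (\<lambda>s. inv\<^bsub>G\<^esub> s) ` S \<and>
        foldr (\<lambda>a b. a \<otimes>\<^bsub>G\<^esub> b) ws \<one>\<^bsub>G\<^esub> = g)"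

definition word_metric :: "('a, 'b) monoid_scheme \<Rightarrow> 'a set \<Rightarrow> 'a \<Rightarrow> 'a \<Rightarrow> real" where
  "word_metric G S g h = real (word_length G S (inv\<^bsub>G\<^esub> g \<otimes>\<^bsub>G\<^esub> h))"

definition cayley_edge :: "('a, 'b) monoid_scheme \<Rightarrow> 'a set \<Rightarrow> 'a \<Rightarrow> 'a \<Rightarrow> bool" where
  "cayley_edge G S g h \<longleftrightarrow> g \<noteq> h \<and> (\<exists>s\<in>S. h = g \<otimes>\<^bsub>G\<^esub> s \<or> g = h \<otimes>\<^bsub>G\<^esub> s)"

definition hyperbolic_group :: "('a, 'b) monoid_scheme \<Rightarrow> bool" where
  "hyperbolic_group G \<longleftrightarrow>
     group G \<and>
     (\<exists>S. finite_generating_set G S \<and>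
        hyperbolic_space (realization (carrier G) (cayley_edge G S))
                         (path_metric (carrier G) (cayley_edge G S)))"

text \<open>The Hilbert space compression of a group, computed with the word metric of a given finite
  generating set.\<close>

definition group_hilbert_compression :: "('a, 'b) monoid_scheme \<Rightarrow> 'a set \<Rightarrow> ennreal" where
  "group_hilbert_compression G S = hilbert_compression (carrier G) (word_metric G S)"

end

theory Submission
  imports Defs
begin

text \<open>Idea. Fix a spanning tree of geodesics towards \<open>1\<close>. By thinness of triangles, tree ancestors of
  nearby elements at a common level are within a constant \<open>\<Delta>\<close> of each other. Consider the random
  descent that repeatedly jumps \<open>R\<close> levels down the tree and then moves to a uniformly chosen point of
  the same level within \<open>\<Delta>\<close>. Two nearby elements can be coupled to coincide after each jump with
  probability bounded below, so their distributions after \<open>k\<close> jumps, viewed as vectors \<open>g k\<close> of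
  \<open>\<ell>\<^sup>2\<close>, differ by \<open>O(l ^ k)\<close> with \<open>l < 1\<close>, although they live on sets of bounded size and hence have
  norm bounded below. Summing \<open>(k + 1) powr \<beta> *\<^sub>R g k\<close> over the \<open>k\<close> jumps down to the root gives, for
  \<open>\<beta> < 1 / 2\<close>, a Lipschitz map. The first jumps, of number proportional to \<open>d x y\<close>, have disjoint
  supports for \<open>x\<close> and \<open>y\<close>, so it has compression at least of order \<open>t powr (\<beta> + 1 / 2)\<close>.\<close>

section \<open>Graph metrics and discrete geodesics\<close>

locale graph_metric =
  fixes X :: "'a set" and d :: "'a \<Rightarrow> 'a \<Rightarrow> nat"
  assumes d_zero: "\<And>x y. x \<in> X \<Longrightarrow> y \<in> X \<Longrightarrow> d x y = 0 \<longleftrightarrow> x = y"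
    and d_sym: "\<And>x y. x \<in> X \<Longrightarrow> y \<in> X \<Longrightarrow> d x y = d y x"
    and d_tri: "\<And>x y z. x \<in> X \<Longrightarrow> y \<in> X \<Longrightarrow> z \<in> X \<Longrightarrow> d x z \<le> d x y + d y z"
    and d_chain: "\<And>x y n. x \<in> X \<Longrightarrow> y \<in> X \<Longrightarrow> d x y = Suc n \<Longrightarrow> \<exists>z\<in>X. d x z = n \<and> d z y = 1"
begin

lemma d_self [simp]: "x \<in> X \<Longrightarrow> d x x = 0" using d_zero by blast

definition geod :: "(nat \<Rightarrow> 'a) \<Rightarrow> nat \<Rightarrow> bool" where
  "geod \<gamma> n \<longleftrightarrow> (\<forall>i\<le>n. \<gamma> i \<in> X) \<and> (\<forall>i j. i \<le> j \<longrightarrow> j \<le> n \<longrightarrow> d (\<gamma> i) (\<gamma> j) = j - i)"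

text \<open>A path of \<open>n\<close> steps of length at most 1 whose ends are \<open>n\<close>
  apart leaves no slack: a shorter distance between two intermediate points would shorten the whole
  path by the triangle inequality.\<close>

lemma geodI:
  assumes X: "\<And>i. i \<le> n \<Longrightarrow> \<gamma> i \<in> X" and step: "\<And>i. i < n \<Longrightarrow> d (\<gamma> i) (\<gamma> (Suc i)) \<le> 1"
    and long: "n \<le> d (\<gamma> 0) (\<gamma> n)"
  shows "geod \<gamma> n"
proof -
  have le: "d (\<gamma> i) (\<gamma> (i + k)) \<le> k" if "i + k \<le> n" for i k
    using that
  proof (induction k)
    case 0
    then show ?case using X by simp
  next
    case (Suc k)
    then show ?case
      using d_tri[of "\<gamma> i" "\<gamma> (i + k)" "\<gamma> (Suc (i + k))"] step[of "i + k"] X by simp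
  qed
  have "d (\<gamma> i) (\<gamma> j) = j - i" if ij: "i \<le> j" "j \<le> n" for i j
  proof -
    have "n \<le> d (\<gamma> 0) (\<gamma> i) + (d (\<gamma> i) (\<gamma> j) + d (\<gamma> j) (\<gamma> n))"
      using long d_tri[of "\<gamma> 0" "\<gamma> i" "\<gamma> n"] d_tri[of "\<gamma> i" "\<gamma> j" "\<gamma> n"] X ij by simp
    then show ?thesis
      using le[of 0 i] le[of i "j - i"] le[of j "n - j"] ij by simp
  qed
  then show ?thesis using X by (simp add: geod_def)
qed

lemma geod_in: "geod \<gamma> n \<Longrightarrow> i \<le> n \<Longrightarrow> \<gamma> i \<in> X"
  by (simp add: geod_def)

lemma geod_dist: "geod \<gamma> n \<Longrightarrow> i \<le> j \<Longrightarrow> j \<le> n \<Longrightarrow> d (\<gamma> i) (\<gamma> j) = j - i"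
  by (simp add: geod_def)

lemma geod_rev:
  assumes "geod \<gamma> n"
  shows "geod (\<lambda>i. \<gamma> (n - i)) n"
proof (rule geodI)
  show "d (\<gamma> (n - i)) (\<gamma> (n - Suc i)) \<le> 1" if "i < n" for i
    using that geod_dist[OF assms, of "n - Suc i" "n - i"] geod_in[OF assms]
      d_sym[of "\<gamma> (n - i)" "\<gamma> (n - Suc i)"] by simp
  show "n \<le> d (\<gamma> (n - 0)) (\<gamma> (n - n))"
    using geod_dist[OF assms, of 0 n] geod_in[OF assms] d_sym[of "\<gamma> 0" "\<gamma> n"] by simp
qed (use geod_in[OF assms] in auto)

lemma geod_exists:
  assumes "x \<in> X" "y \<in> X"
  shows "\<exists>\<gamma>. \<gamma> 0 = x \<and> \<gamma> (d x y) = y \<and> geod \<gamma> (d x y)"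
proof -
  have "\<exists>\<gamma>. \<gamma> 0 = x \<and> \<gamma> n = y \<and> (\<forall>i\<le>n. \<gamma> i \<in> X) \<and> (\<forall>i<n. d (\<gamma> i) (\<gamma> (Suc i)) \<le> 1)"
    if "y \<in> X" "d x y = n" for n y
    using that
  proof (induction n arbitrary: y)
    case 0
    then show ?case using d_zero assms by (intro exI[of _ "\<lambda>_. x"]) auto
  next
    case (Suc n)
    then obtain z where z: "z \<in> X" "d x z = n" "d z y = 1" using d_chain[OF assms(1) Suc.prems] by blast
    from Suc.IH[OF z(1,2)] obtain \<gamma> where
      "\<gamma> 0 = x" "\<gamma> n = z" "\<forall>i\<le>n. \<gamma> i \<in> X" "\<forall>i<n. d (\<gamma> i) (\<gamma> (Suc i)) \<le> 1" by blast
    then show ?case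
      using Suc.prems z by (intro exI[of _ "\<gamma>(Suc n := y)"]) (auto simp: le_Suc_eq less_Suc_eq)
  qed
  from this[OF assms(2) HOL.refl] obtain \<gamma> where
    "\<gamma> 0 = x" "\<gamma> (d x y) = y" "\<forall>i\<le>d x y. \<gamma> i \<in> X" "\<forall>i<d x y. d (\<gamma> i) (\<gamma> (Suc i)) \<le> 1" by blast
  then show ?thesis by (intro exI[of _ \<gamma>] conjI geodI) auto
qed

end

section \<open>Geometric realization and thin triangles\<close>

lemma edge_point_0: "edge_point u v 0 = indicator {u}"
  by (simp add: edge_point_def)

lemma edge_point_1: "edge_point u v 1 = indicator {v}"
  by (simp add: edge_point_def)

lemma vertex_in_realization: "u \<in> V \<Longrightarrow> indicator {u} \<in> realization V E"
  unfolding realization_def by (intro CollectI exI[of _ u] exI[of _ "0::real"]) (simp add: edge_point_0)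

lemma edge_in_realization:
  "u \<in> V \<Longrightarrow> v \<in> V \<Longrightarrow> E u v \<Longrightarrow> t \<in> {0..1} \<Longrightarrow> edge_point u v t \<in> realization V E"
  unfolding realization_def by auto

text \<open>The affine extension of a \<open>1\<close>-Lipschitz function on the vertices is \<open>1\<close>-Lipschitz along paths;
  applied to distance functions, it bounds the path metric from below.\<close>

definition barycentric_extension :: "('a \<Rightarrow> nat) \<Rightarrow> ('a \<Rightarrow> real) \<Rightarrow> real" where
  "barycentric_extension f p = (\<Sum>w | p w \<noteq> 0. p w * real (f w))"

lemma barycentric_extension_edge_point:
  "barycentric_extension f (edge_point u v t) = (1 - t) * real (f u) + t * real (f v)"
proof -
  have "barycentric_extension f (edge_point u v t) = (\<Sum>w\<in>{u, v}. edge_point u v t w * real (f w))"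
    unfolding barycentric_extension_def
    by (rule sum.mono_neutral_left) (auto simp: edge_point_def split: split_indicator_asm)
  then show ?thesis
    by (cases "u = v") (auto simp: edge_point_def algebra_simps)
qed

lemma has_path_nonneg: "has_path_of_length V E p q l \<Longrightarrow> 0 \<le> l"
  by (induction rule: has_path_of_length.induct) auto

lemma path_metric_le:
  assumes "p \<in> realization V E" "q \<in> realization V E" "has_path_of_length V E p q l"
  shows "path_metric V E p q \<le> l"
  unfolding path_metric_def using assms has_path_nonneg[of V E p q]
  by (auto intro!: cInf_lower bdd_belowI[of _ 0])

lemma barycentric_extension_lipschitz:
  assumes f: "\<And>u v. u \<in> V \<Longrightarrow> v \<in> V \<Longrightarrow> E u v \<Longrightarrow> \<bar>real (f u) - real (f v)\<bar> \<le> 1"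
    and "has_path_of_length V E p q l"
  shows "\<bar>barycentric_extension f q - barycentric_extension f p\<bar> \<le> l"
  using assms(2)
proof (induction rule: has_path_of_length.induct)
  case (step p u v s l t)
  let ?F = "barycentric_extension f"
  have "?F (edge_point u v t) - ?F (edge_point u v s) = (s - t) * (real (f u) - real (f v))"
    by (simp add: barycentric_extension_edge_point algebra_simps)
  then have "\<bar>?F (edge_point u v t) - ?F (edge_point u v s)\<bar> \<le> \<bar>s - t\<bar>"
    using f[OF step.hyps(2-4)] by (simp add: abs_mult mult_left_le)
  then show ?case using step.IH by linarith
qed simp

text \<open>Some path between the points is assumed so that the infimum runs over a nonempty
  set.\<close>

lemma path_metric_ge:
  assumes f: "\<And>u v. u \<in> V \<Longrightarrow> v \<in> V \<Longrightarrow> E u v \<Longrightarrow> \<bar>real (f u) - real (f v)\<bar> \<le> 1"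
    and pq: "p \<in> realization V E" "q \<in> realization V E" "has_path_of_length V E p q l"
  shows "\<bar>barycentric_extension f q - barycentric_extension f p\<bar> \<le> path_metric V E p q"
  unfolding path_metric_def using pq barycentric_extension_lipschitz[OF f]
  by (auto intro!: cInf_greatest)

locale realized_graph = graph_metric X d for X :: "'a set" and d +
  fixes E :: "'a \<Rightarrow> 'a \<Rightarrow> bool"
  assumes edge_iff: "\<And>x y. x \<in> X \<Longrightarrow> y \<in> X \<Longrightarrow> E x y \<longleftrightarrow> d x y = 1"
    and metric: "Metric_space (realization X E) (path_metric X E)"
begin

abbreviation "pm \<equiv> path_metric X E"

text \<open>The unit-speed path through the vertices of a discrete geodesic. At \<open>t = n\<close>
  the edge degenerates to the last vertex, and \<open>min\<close> keeps the next index within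
  range.\<close>

definition curve :: "(nat \<Rightarrow> 'a) \<Rightarrow> nat \<Rightarrow> real \<Rightarrow> 'a \<Rightarrow> real" where
  "curve \<gamma> n t = edge_point (\<gamma> (nat \<lfloor>t\<rfloor>)) (\<gamma> (min n (Suc (nat \<lfloor>t\<rfloor>)))) (t - \<lfloor>t\<rfloor>)"

lemma curve_vertex: "curve \<gamma> n (real i) = indicator {\<gamma> i}"
  by (simp add: curve_def edge_point_0)

text \<open>At the right end the floor has already moved on by one; the two formulas agree at the
  common vertex.\<close>

lemma curve_edge:
  assumes "i < n" "real i \<le> t" "t \<le> real (Suc i)"
  shows "curve \<gamma> n t = edge_point (\<gamma> i) (\<gamma> (Suc i)) (t - real i)"
proof (cases "t = real (Suc i)")
  case True
  then show ?thesis using curve_vertex[of \<gamma> n "Suc i"] by (simp add: edge_point_1)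
next
  case False
  then have "\<lfloor>t\<rfloor> = int i" using assms by (intro floor_unique) auto
  then show ?thesis using assms by (simp add: curve_def)
qed

lemma curve_in:
  assumes "geod \<gamma> n" "0 \<le> t" "t \<le> real n"
  shows "curve \<gamma> n t \<in> realization X E"
proof (cases "t = real n")
  case True
  then show ?thesis using curve_vertex[of \<gamma> n n] vertex_in_realization[OF geod_in[OF assms(1)], of n] by simp
next
  case False
  define i where "i = nat \<lfloor>t\<rfloor>"
  have i: "real i \<le> t" "t \<le> real (Suc i)" "i < n"
    using assms False unfolding i_def by linarith+
  then show ?thesis
    using geod_in[OF assms(1)] geod_dist[OF assms(1), of i "Suc i"]
    unfolding curve_edge[OF i(3,1,2)] by (intro edge_in_realization) (auto simp: edge_iff)
qed

lemma curve_path: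
  assumes "geod \<gamma> n" "0 \<le> s" "s \<le> t" "t \<le> real n"
  shows "has_path_of_length X E (curve \<gamma> n s) (curve \<gamma> n t) (t - s)"
proof -
  have "has_path_of_length X E (curve \<gamma> n s) (curve \<gamma> n t) (t - s)"
    if "m \<le> n" "s \<le> t" "t \<le> real m" for m t
    using that
  proof (induction m arbitrary: t)
    case 0
    then have "s = 0" "t = 0" using assms by auto
    then show ?case using has_path_of_length.refl curve_in[OF assms(1)] by force
  next
    case (Suc m)
    show ?case
    proof (cases "t \<le> real m")
      case True
      then show ?thesis using Suc by simp
    next
      case False
      have m: "m < n" using Suc by simp
      \<comment> \<open>The subpath is cut at the vertex \<open>m\<close>, or at \<open>s\<close> if
        it starts beyond that vertex. What precedes the cut comes from the induction hypothesis or
        is trivial; what follows is one \<open>step\<close> along an edge.\<close>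
      define r where "r = max s (real m)"
      have r: "real m \<le> r" "r \<le> t" "r \<le> real (Suc m)" "s \<le> r"
        using False Suc by (auto simp: r_def)
      have "has_path_of_length X E (curve \<gamma> n s) (curve \<gamma> n r) (r - s)"
      proof (cases "s \<le> real m")
        case True
        then show ?thesis using Suc.IH[of "real m"] Suc.prems by (simp add: r_def max_def)
      next
        case s: False
        then have "s \<le> real n" using r Suc.prems assms by linarith
        then show ?thesis
          using s has_path_of_length.refl[OF curve_in[OF assms(1,2)]] by (simp add: r_def max_def)
      qed
      then have "has_path_of_length X E (curve \<gamma> n s)
          (edge_point (\<gamma> m) (\<gamma> (Suc m)) (t - real m)) (r - s + \<bar>(r - real m) - (t - real m)\<bar>)"
        unfolding curve_edge[OF m r(1,3)]
        using m r Suc.prems geod_in[OF assms(1)] geod_dist[OF assms(1), of m "Suc m"]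
        by (intro has_path_of_length.step) (auto simp: edge_iff)
      moreover have "r - s + \<bar>(r - real m) - (t - real m)\<bar> = t - s" using r by simp
      ultimately show ?thesis
        using curve_edge[OF m, of t \<gamma>] r Suc.prems by simp
    qed
  qed
  then show ?thesis using assms by blast
qed

lemma lev_lipschitz_edge:
  assumes "z \<in> X" "u \<in> X" "v \<in> X" "E u v"
  shows "\<bar>real (d z u) - real (d z v)\<bar> \<le> 1"
  using d_tri[of z u v] d_tri[of z v u] d_sym[of u v] assms edge_iff by auto

lemma barycentric_extension_curve:
  assumes "geod \<gamma> n" "0 \<le> t" "t \<le> real n"
  shows "barycentric_extension (d (\<gamma> 0)) (curve \<gamma> n t) = t"
proof (cases "t = real n")
  case True
  then show ?thesis
    using barycentric_extension_edge_point[of "d (\<gamma> 0)" "\<gamma> n" "\<gamma> n" 0] geod_dist[OF assms(1), of 0 n]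
    by (simp add: curve_vertex edge_point_0)
next
  case False
  define i where "i = nat \<lfloor>t\<rfloor>"
  have i: "real i \<le> t" "t \<le> real (Suc i)" "i < n"
    using assms False unfolding i_def by linarith+
  then show ?thesis
    using geod_dist[OF assms(1), of 0 i] geod_dist[OF assms(1), of 0 "Suc i"]
    unfolding curve_edge[OF i(3,1,2)] barycentric_extension_edge_point by (simp add: algebra_simps)
qed

text \<open>The curve itself is a path of length \<open>t - s\<close>. Conversely, the distance from
  the initial vertex extends to a 1-Lipschitz function that reads off the parameter of the
  curve.\<close>

lemma curve_dist:
  assumes "geod \<gamma> n" "s \<in> {0..real n}" "t \<in> {0..real n}"
  shows "pm (curve \<gamma> n s) (curve \<gamma> n t) = \<bar>s - t\<bar>"
proof -
  have *: "pm (curve \<gamma> n s) (curve \<gamma> n t) = t - s" if "0 \<le> s" "s \<le> t" "t \<le> real n" for s t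
  proof (rule antisym)
    note path = curve_path[OF assms(1) that]
    have "s \<le> real n" "0 \<le> t" using that by auto
    note in' = curve_in[OF assms(1) that(1) this(1)] curve_in[OF assms(1) this(2) that(3)]
    show "pm (curve \<gamma> n s) (curve \<gamma> n t) \<le> t - s"
      by (rule path_metric_le[OF in' path])
    have "\<gamma> 0 \<in> X" using geod_in[OF assms(1)] by simp
    from path_metric_ge[where f = "d (\<gamma> 0)", OF lev_lipschitz_edge[OF this] in' path]
    show "t - s \<le> pm (curve \<gamma> n s) (curve \<gamma> n t)"
      using barycentric_extension_curve[OF assms(1)] that by simp
  qed
  show ?thesis
  proof (cases "s \<le> t")
    case True
    then show ?thesis using * assms by simp
  next
    case False
    then show ?thesis
      using *[of t s] assms Metric_space.commute[OF metric, of "curve \<gamma> n s"] by simp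
  qed
qed

lemma curve_geodesic:
  assumes "geod \<gamma> n"
  shows "geodesic_segment (realization X E) pm (indicator {\<gamma> 0}) (indicator {\<gamma> n}) (curve \<gamma> n ` {0..real n})"
  unfolding geodesic_segment_def
  by (intro exI[of _ "real n"] exI[of _ "curve \<gamma> n"])
    (use curve_in[OF assms] curve_dist[OF assms] curve_vertex[of \<gamma> n 0] curve_vertex[of \<gamma> n n] in auto)

lemma pm_vertex:
  assumes "x \<in> X" "y \<in> X"
  shows "pm (indicator {x}) (indicator {y}) = real (d x y)"
proof -
  obtain \<gamma> where \<gamma>: "\<gamma> 0 = x" "\<gamma> (d x y) = y" "geod \<gamma> (d x y)"
    using geod_exists assms by blast
  then show ?thesis
    using curve_dist[OF \<gamma>(3), of 0 "real (d x y)"] curve_vertex[of \<gamma> "d x y" 0]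
      curve_vertex[of \<gamma> "d x y" "d x y"] by simp
qed

lemma near_vertex:
  assumes "geod \<gamma> n" "a \<in> curve \<gamma> n ` {0..real n}"
  shows "\<exists>i\<le>n. pm a (indicator {\<gamma> i}) \<le> 1"
proof -
  obtain t where t: "t \<in> {0..real n}" "a = curve \<gamma> n t" using assms by blast
  define i where "i = nat \<lfloor>t\<rfloor>"
  have i: "real i \<le> t" "t \<le> real i + 1" "i \<le> n"
    using t(1) unfolding i_def atLeastAtMost_iff by linarith+
  then have "pm a (indicator {\<gamma> i}) = \<bar>t - real i\<bar>"
    unfolding t(2) curve_vertex[of \<gamma> n i, symmetric] using t(1) by (intro curve_dist[OF assms(1)]) auto
  then show ?thesis using i by (intro exI[of _ i]) simp
qed

text \<open>The vertices are joined by curves in the realization, where thinness applies. The point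
  found on another side is within 1 of a vertex of that side, which accounts for
  \<open>\<delta> + 1\<close>.\<close>

lemma discrete_thin:
  assumes thin: "\<And>A B C. geodesic_triangle (realization X E) pm A B C \<Longrightarrow> thin_triangle (realization X E) pm \<delta> A B C"
    and geod: "geod \<alpha> l" "geod \<beta> m" "geod \<gamma> n"
    and ends: "\<alpha> l = \<beta> 0" "\<beta> m = \<gamma> 0" "\<gamma> n = \<alpha> 0" and i: "i \<le> l"
  shows "(\<exists>j\<le>m. real (d (\<alpha> i) (\<beta> j)) < \<delta> + 1) \<or> (\<exists>j\<le>n. real (d (\<alpha> i) (\<gamma> j)) < \<delta> + 1)"
proof -
  let ?A = "curve \<alpha> l ` {0..real l}" and ?B = "curve \<beta> m ` {0..real m}" and ?C = "curve \<gamma> n ` {0..real n}"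
  have "geodesic_triangle (realization X E) pm ?A ?B ?C"
    unfolding geodesic_triangle_def
  proof (intro bexI conjI)
    show "geodesic_segment (realization X E) pm (indicator {\<alpha> 0}) (indicator {\<alpha> l}) ?A"
      by (rule curve_geodesic[OF geod(1)])
    show "geodesic_segment (realization X E) pm (indicator {\<alpha> l}) (indicator {\<gamma> 0}) ?B"
      using curve_geodesic[OF geod(2)] unfolding ends .
    show "geodesic_segment (realization X E) pm (indicator {\<gamma> 0}) (indicator {\<alpha> 0}) ?C"
      using curve_geodesic[OF geod(3)] unfolding ends .
    show "indicator {\<alpha> 0} \<in> realization X E" "indicator {\<alpha> l} \<in> realization X E"
      "indicator {\<gamma> 0} \<in> realization X E"
      by (intro vertex_in_realization geod_in[OF geod(1)] geod_in[OF geod(3)]; simp)+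
  qed
  then have "?A \<subseteq> nbhd (realization X E) pm \<delta> (?B \<union> ?C)"
    using thin unfolding thin_triangle_def by blast
  moreover have "curve \<alpha> l (real i) \<in> ?A" using i by auto
  ultimately obtain a where a: "a \<in> ?B \<union> ?C" "pm (indicator {\<alpha> i}) a < \<delta>"
    unfolding nbhd_def curve_vertex by blast
  have aX: "a \<in> realization X E"
    using a curve_in[OF geod(2)] curve_in[OF geod(3)] by auto
  have close: "real (d (\<alpha> i) v) < \<delta> + 1" if "v \<in> X" "pm a (indicator {v}) \<le> 1" for v
    using Metric_space.triangle[OF metric vertex_in_realization[OF geod_in[OF geod(1) i]] aX
        vertex_in_realization[OF that(1)]]
      pm_vertex[OF geod_in[OF geod(1) i] that(1)] that(2) a(2) by linarith
  from a(1) show ?thesis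
  proof
    assume "a \<in> ?B"
    then obtain j where "j \<le> m" "pm a (indicator {\<beta> j}) \<le> 1" using near_vertex[OF geod(2)] by blast
    then show ?thesis using close geod_in[OF geod(2)] by blast
  next
    assume "a \<in> ?C"
    then obtain j where "j \<le> n" "pm a (indicator {\<gamma> j}) \<le> 1" using near_vertex[OF geod(3)] by blast
    then show ?thesis using close geod_in[OF geod(3)] by blast
  qed
qed

text \<open>In the triangle formed by the two geodesics and one joining their far ends,
  \<open>\<alpha> i\<close> is too far from \<open>\<alpha> l\<close> to be near the third side, so
  it is near some \<open>\<gamma> k\<close>. The distances \<open>i\<close> and \<open>k\<close>
  from the common origin then differ by at most \<open>d (\<alpha> i) (\<gamma> k)\<close>, so
  passing from \<open>\<gamma> k\<close> to \<open>\<gamma> i\<close> at most doubles the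
  bound.\<close>

lemma geodesics_fellow_travel:
  assumes thin: "\<And>A B C. geodesic_triangle (realization X E) pm A B C \<Longrightarrow> thin_triangle (realization X E) pm \<delta> A B C"
    and geod: "geod \<alpha> l" "geod \<gamma> n" and ends: "\<alpha> 0 = \<gamma> 0"
    and i: "i \<le> n" "real (i + d (\<alpha> l) (\<gamma> n)) + \<delta> + 1 \<le> real l"
    and \<delta>: "0 \<le> \<delta>"
  shows "real (d (\<alpha> i) (\<gamma> i)) \<le> 2 * (\<delta> + 1)"
proof -
  have il: "i \<le> l" using i(2) \<delta> by linarith
  note A = geod_in[OF geod(1)] and C = geod_in[OF geod(2)]
  obtain \<beta> where \<beta>: "\<beta> 0 = \<alpha> l" "\<beta> (d (\<alpha> l) (\<gamma> n)) = \<gamma> n" "geod \<beta> (d (\<alpha> l) (\<gamma> n))"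
    using geod_exists A C by blast
  \<comment> \<open>The sides of a triangle follow each other cyclically, so \<open>\<gamma>\<close>
    is traversed backwards.\<close>
  have "(\<exists>j\<le>d (\<alpha> l) (\<gamma> n). real (d (\<alpha> i) (\<beta> j)) < \<delta> + 1) \<or> (\<exists>j\<le>n. real (d (\<alpha> i) (\<gamma> (n - j))) < \<delta> + 1)"
    by (rule discrete_thin[OF thin geod(1) \<beta>(3) geod_rev[OF geod(2)]]) (use \<beta> ends il in auto)
  then show ?thesis
  proof (elim disjE exE conjE)
    fix j assume j: "j \<le> d (\<alpha> l) (\<gamma> n)" "real (d (\<alpha> i) (\<beta> j)) < \<delta> + 1"
    have "d (\<alpha> l) (\<beta> j) \<le> d (\<alpha> l) (\<gamma> n)"
      using geod_dist[OF \<beta>(3), of 0 j] j \<beta> by simp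
    moreover have "d (\<alpha> l) (\<alpha> i) = l - i"
      using geod_dist[OF geod(1) il] d_sym[of "\<alpha> l" "\<alpha> i"] A il by simp
    moreover have "d (\<alpha> l) (\<alpha> i) \<le> d (\<alpha> l) (\<beta> j) + d (\<alpha> i) (\<beta> j)"
      using d_tri[of "\<alpha> l" "\<beta> j" "\<alpha> i"] d_sym[of "\<alpha> i" "\<beta> j"] A geod_in[OF \<beta>(3)] il j by simp
    \<comment> \<open>Together with \<open>j(2)\<close> this contradicts \<open>i(2)\<close>, so the
      case does not occur.\<close>
    ultimately have "real l \<le> real i + real (d (\<alpha> l) (\<gamma> n)) + real (d (\<alpha> i) (\<beta> j))"
      using il by linarith
    then show ?thesis using i(2) j(2) by simp
  next
    fix j assume j: "j \<le> n" "real (d (\<alpha> i) (\<gamma> (n - j))) < \<delta> + 1"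
    define k where "k = n - j"
    have k: "k \<le> n" "real (d (\<alpha> i) (\<gamma> k)) < \<delta> + 1" using j by (auto simp: k_def)
    have lev: "d (\<gamma> 0) (\<alpha> i) = i" "d (\<gamma> 0) (\<gamma> k) = k"
      using geod_dist[OF geod(1), of 0 i] geod_dist[OF geod(2), of 0 k] il k ends by auto
    have V: "\<gamma> 0 \<in> X" "\<alpha> i \<in> X" "\<gamma> k \<in> X" "\<gamma> i \<in> X" using A C il k i by auto
    have "k \<le> i + d (\<alpha> i) (\<gamma> k)" "i \<le> k + d (\<alpha> i) (\<gamma> k)"
      using d_tri[of "\<gamma> 0" "\<alpha> i" "\<gamma> k"] d_tri[of "\<gamma> 0" "\<gamma> k" "\<alpha> i"] d_sym[of "\<alpha> i" "\<gamma> k"] lev V by simp_all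
    moreover have "d (\<gamma> k) (\<gamma> i) = (if i \<le> k then k - i else i - k)"
      using geod_dist[OF geod(2), of i k] geod_dist[OF geod(2), of k i] k i d_sym[of "\<gamma> i" "\<gamma> k"] V by simp
    ultimately have "d (\<gamma> k) (\<gamma> i) \<le> d (\<alpha> i) (\<gamma> k)" by auto
    then have "d (\<alpha> i) (\<gamma> i) \<le> 2 * d (\<alpha> i) (\<gamma> k)"
      using d_tri[of "\<alpha> i" "\<gamma> k" "\<gamma> i"] V by simp
    then have "real (d (\<alpha> i) (\<gamma> i)) \<le> 2 * real (d (\<alpha> i) (\<gamma> k))"
      by (metis of_nat_le_iff of_nat_mult of_nat_numeral)
    then show ?thesis using k(2) by (simp add: algebra_simps)
  qed
qed

end

section \<open>Spanning trees of geodesics\<close>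

text \<open>Truncated subtraction makes the root its own parent. This is why \<open>par_near\<close>
  demands only \<open>\<le> 1\<close>, and why iterates of \<open>par\<close> stay at the root once
  they reach it.\<close>

locale spanning_tree = graph_metric X d for X :: "'a set" and d +
  fixes root :: 'a and par :: "'a \<Rightarrow> 'a"
  assumes root: "root \<in> X"
    and par_in: "\<And>x. x \<in> X \<Longrightarrow> par x \<in> X"
    and par_lev: "\<And>x. x \<in> X \<Longrightarrow> d root (par x) = d root x - 1"
    and par_near: "\<And>x. x \<in> X \<Longrightarrow> d x (par x) \<le> 1"
begin

abbreviation lev :: "'a \<Rightarrow> nat" where "lev x \<equiv> d root x"

abbreviation anc :: "nat \<Rightarrow> 'a \<Rightarrow> 'a" where "anc k \<equiv> par ^^ k"

lemma anc_in: "x \<in> X \<Longrightarrow> anc k x \<in> X"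
  by (induction k) (auto intro: par_in)

lemma anc_lev: "x \<in> X \<Longrightarrow> lev (anc k x) = lev x - k"
  by (induction k) (auto simp: par_lev anc_in)

lemma anc_near: "x \<in> X \<Longrightarrow> d x (anc k x) \<le> k"
proof (induction k)
  case (Suc k)
  then show ?case
    using d_tri[of x "anc k x" "anc (Suc k) x"] par_near[of "anc k x"]
    by (auto simp: anc_in par_in)
qed auto

lemma anc_root: "x \<in> X \<Longrightarrow> lev x \<le> k \<Longrightarrow> anc k x = root"
  using anc_lev[of x k] d_zero[OF root anc_in, of x k] by simp

text \<open>The tree path is read from the root outwards, so that all these geodesics have the
  common origin needed for fellow travelling.\<close>

lemma anc_geod:
  assumes "x \<in> X"
  shows "geod (\<lambda>i. anc (lev x - i) x) (lev x)"
proof (rule geodI)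
  fix i assume "i < lev x"
  then have "lev x - i = Suc (lev x - Suc i)" by simp
  then show "d (anc (lev x - i) x) (anc (lev x - Suc i) x) \<le> 1"
    using par_near[OF anc_in[OF assms]] d_sym[OF anc_in[OF assms] par_in[OF anc_in[OF assms]]] by simp
next
  show "lev x \<le> d (anc (lev x - 0) x) (anc (lev x - lev x) x)"
    using anc_root[OF assms, of "lev x"] by simp
qed (use anc_in[OF assms] in auto)

end

text \<open>The parent of \<open>x\<close> is the last vertex before \<open>x\<close> on some
  geodesic from the root.\<close>

lemma (in graph_metric) spanning_tree_exists:
  fixes root :: 'a
  assumes "root \<in> X"
  shows "\<exists>par. spanning_tree X d root par"
proof -
  have "\<exists>y\<in>X. d root y = d root x - 1 \<and> d x y \<le> 1" if "x \<in> X" for x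
  proof (cases "d root x")
    case 0
    then show ?thesis using that by (intro bexI[of _ x]) auto
  next
    case (Suc n)
    then show ?thesis using d_chain[OF assms that Suc] d_sym[of x] that by force
  qed
  then obtain par where "\<And>x. x \<in> X \<Longrightarrow> par x \<in> X \<and> d root (par x) = d root x - 1 \<and> d x (par x) \<le> 1"
    by metis
  then have "spanning_tree X d root par"
    using assms by unfold_locales auto
  then show ?thesis by blast
qed

section \<open>Averages and orthonormal families\<close>

text \<open>Independent coupling: the difference of the averages is the average of \<open>f a - h b\<close> over
  \<open>A \<times> B\<close>, and the pair \<open>(c, c)\<close> contributes nothing.\<close>

lemma norm_average_diff_le:
  fixes f h :: "'a \<Rightarrow> 'h::real_normed_vector"
  assumes "finite A" "finite B" "c \<in> A" "c \<in> B" "f c = h c" "card A \<le> N" "card B \<le> N" "0 \<le> D"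
    and le: "\<And>a b. a \<in> A \<Longrightarrow> b \<in> B \<Longrightarrow> norm (f a - h b) \<le> D"
  shows "norm ((1 / card A) *\<^sub>R sum f A - (1 / card B) *\<^sub>R sum h B) \<le> (1 - 1 / (real N)\<^sup>2) * D"
proof -
  define n where "n = real (card A) * real (card B)"
  have cA: "card A \<ge> 1" and cB: "card B \<ge> 1"
    using assms by (auto simp: Suc_le_eq card_gt_0_iff)
  then have n: "n > 0" "n \<le> (real N)\<^sup>2"
    using assms by (auto simp: n_def power2_eq_square intro!: mult_mono)
  have "(\<Sum>(a,b)\<in>A \<times> B. f a - h b) = real (card B) *\<^sub>R sum f A - real (card A) *\<^sub>R sum h B"
    by (simp add: sum.cartesian_product[symmetric] sum_subtractf sum_constant_scaleR
        flip: scaleR_sum_right)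
  then have eq: "(1 / card A) *\<^sub>R sum f A - (1 / card B) *\<^sub>R sum h B
      = (1 / n) *\<^sub>R (\<Sum>(a,b)\<in>A \<times> B. f a - h b)"
    using cA cB by (simp add: n_def scaleR_diff_right)
  have "norm (\<Sum>(a,b)\<in>A \<times> B. f a - h b) = norm (\<Sum>(a,b)\<in>A \<times> B - {(c,c)}. f a - h b)"
    using assms by (subst sum.remove[of _ "(c,c)"]) auto
  also have "\<dots> \<le> real (card (A \<times> B - {(c,c)})) * D"
    by (rule sum_norm_bound) (use le in auto)
  also have "real (card (A \<times> B - {(c,c)})) = n - 1"
  proof -
    have "card (A \<times> B - {(c,c)}) = card A * card B - 1"
      using assms by (subst card_Diff_singleton) (auto simp: card_cartesian_product)
    moreover have "card A * card B \<ge> 1"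
      using cA cB by (metis mult_le_mono nat_mult_1)
    ultimately show ?thesis by (simp add: n_def of_nat_diff)
  qed
  finally have "norm ((1 / card A) *\<^sub>R sum f A - (1 / card B) *\<^sub>R sum h B) \<le> (1 - 1 / n) * D"
    using n unfolding eq by (simp add: field_simps)
  also have "\<dots> \<le> (1 - 1 / (real N)\<^sup>2) * D"
    using n \<open>0 \<le> D\<close> by (intro mult_right_mono) (auto simp: frac_le)
  finally show ?thesis .
qed

lemma average_mem_convex:
  fixes f :: "'a \<Rightarrow> 'h::real_vector"
  assumes "finite A" "A \<noteq> {}" "convex C" "\<And>a. a \<in> A \<Longrightarrow> f a \<in> C"
  shows "(1 / card A) *\<^sub>R sum f A \<in> C"
proof -
  have "(\<Sum>a\<in>A. (1 / card A) *\<^sub>R f a) \<in> C"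
    by (rule convex_sum) (use assms in auto)
  then show ?thesis by (simp add: scaleR_sum_right)
qed

section \<open>Sums of powers\<close>

lemma summable_Suc_powr_mult_power:
  fixes l :: real
  assumes "0 \<le> l" "l < 1" "a \<le> 1"
  shows "summable (\<lambda>k. real (Suc k) powr a * l ^ k)"
proof (rule summable_comparison_test')
  \<comment> \<open>\<open>diffs\<close> yields the coefficients \<open>Suc k\<close> of the
    derivative of the geometric series, which dominates the given one because
    \<open>a \<le> 1\<close>.\<close>
  have "summable (\<lambda>k. diffs (\<lambda>_. 1) k * l ^ k)"
    by (rule termdiff_converges[of _ 1]) (use assms in \<open>auto intro: summable_geometric\<close>)
  then show "summable (\<lambda>k. real (Suc k) * l ^ k)"
    by (simp add: diffs_def)
  fix k :: nat
  have "real (Suc k) powr a \<le> real (Suc k) powr 1"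
    using assms by (intro powr_mono) auto
  then show "norm (real (Suc k) powr a * l ^ k) \<le> real (Suc k) * l ^ k"
    using assms by (auto intro!: mult_right_mono)
qed

text \<open>By the mean value theorem the difference is \<open>b * z powr (b - 1)\<close> at an
  intermediate \<open>z\<close>, and this power decreases in \<open>z\<close>. The bound controls
  the change of the weights when a point enters the next block of levels.\<close>

lemma Suc_powr_diff_le:
  assumes "0 \<le> b" "b \<le> 1"
  shows "\<bar>real (Suc (Suc k)) powr b - real (Suc k) powr b\<bar> \<le> real (Suc k) powr (b - 1)"
proof -
  have "\<exists>z. real (Suc k) < z \<and> z < real (Suc (Suc k)) \<and>
      real (Suc (Suc k)) powr b - real (Suc k) powr b
       = (real (Suc (Suc k)) - real (Suc k)) * (b * z powr (b - 1))"
    by (rule MVT2) (auto intro!: has_real_derivative_powr)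
  then obtain z where z: "real (Suc k) < z" "z < real (Suc (Suc k))"
    "real (Suc (Suc k)) powr b - real (Suc k) powr b
       = (real (Suc (Suc k)) - real (Suc k)) * (b * z powr (b - 1))"
    by blast
  have "z powr (b - 1) \<le> real (Suc k) powr (b - 1)"
    using z assms by (intro powr_mono2') auto
  then have "b * z powr (b - 1) \<le> real (Suc k) powr (b - 1)"
    using assms by (meson mult_left_le_one_le order_trans powr_ge_zero)
  then show ?thesis using z(3) assms by (simp add: abs_mult)
qed

text \<open>Only the indices from \<open>m div 2\<close> on are kept: they are at least
  \<open>m / 2\<close> in number, and each contributes at least
  \<open>(m / 2) powr a\<close>.\<close>

lemma sum_Suc_powr_ge:
  assumes "0 \<le> a"
  shows "(real m / 2) powr (a + 1) \<le> (\<Sum>k<m. real (Suc k) powr a)"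
proof (cases "m = 0")
  case False
  have "(real m / 2) powr (a + 1) = (real m / 2) * (real m / 2) powr a"
    using False by (simp add: powr_add)
  also have "\<dots> \<le> real (card {m div 2..<m}) * (real m / 2) powr a"
    by (intro mult_right_mono) auto
  also have "\<dots> \<le> (\<Sum>k\<in>{m div 2..<m}. real (Suc k) powr a)"
    by (rule sum_bounded_below) (use assms in \<open>auto intro!: powr_mono2\<close>)
  also have "\<dots> \<le> (\<Sum>k<m. real (Suc k) powr a)"
    by (rule sum_mono2) auto
  finally show ?thesis .
qed simp

section \<open>Convex hulls of orthonormal families\<close>

locale orthonormal_family =
  fixes X :: "'a set" and b :: "'a \<Rightarrow> 'h::real_inner"
  assumes orthonormal: "\<And>v w. v \<in> X \<Longrightarrow> w \<in> X \<Longrightarrow> inner (b v) (b w) = (if v = w then 1 else 0)"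
begin

text \<open>Orthogonality to a fixed vector is a convex condition, so it extends from basis vectors
  to convex combinations, first in one argument and then in the other.\<close>

lemma inner_hull_disjoint:
  assumes "S \<subseteq> X" "T \<subseteq> X" "S \<inter> T = {}" "x \<in> convex hull (b ` S)" "y \<in> convex hull (b ` T)"
  shows "inner x y = 0"
proof -
  have 1: "convex {x. inner x y = 0}" for y :: 'h
    by (auto simp: convex_def inner_left_distrib)
  have 2: "convex {y. inner x y = 0}" for x :: 'h
    by (auto simp: convex_def inner_right_distrib)
  have "convex hull (b ` S) \<subseteq> {x. inner x (b t) = 0}" if "t \<in> T" for t
  proof (rule hull_minimal)
    show "b ` S \<subseteq> {x. inner x (b t) = 0}"
      using that assms(1-3) orthonormal by (smt (verit) disjoint_iff image_subsetI mem_Collect_eq subsetD)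
  qed (rule 1)
  then have "convex hull (b ` T) \<subseteq> {y. inner x y = 0}"
    using assms(4) by (intro hull_minimal 2) auto
  then show ?thesis using assms(5) by auto
qed

lemma norm_hull_le:
  assumes "S \<subseteq> X" "x \<in> convex hull (b ` S)"
  shows "norm x \<le> 1"
proof -
  have "b ` S \<subseteq> cball 0 1"
    using assms(1) orthonormal by (auto simp: norm_eq_sqrt_inner)
  then have "convex hull (b ` S) \<subseteq> cball 0 1"
    by (intro hull_minimal) auto
  then show ?thesis using assms(2) by auto
qed

text \<open>The sum \<open>s\<close> of the basis vectors over \<open>S\<close> has inner product 1
  with every convex combination of them, and its norm is the square root of \<open>card S\<close>;
  the bound is Cauchy-Schwarz.\<close>

lemma norm_hull_ge:
  assumes "S \<subseteq> X" "finite S" "card S \<le> N" "x \<in> convex hull (b ` S)"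
  shows "1 \<le> real N * (norm x)\<^sup>2"
proof -
  define s where "s = sum b S"
  have ib: "inner (b v) s = 1" if "v \<in> S" for v
  proof -
    have "inner (b v) s = (\<Sum>w\<in>S. if v = w then 1 else 0)"
      unfolding s_def inner_sum_right using that assms by (intro sum.cong refl orthonormal) auto
    then show ?thesis using that assms by simp
  qed
  have "convex hull (b ` S) \<subseteq> {x. inner x s = 1}"
    by (rule hull_minimal) (auto simp: ib convex_def inner_left_distrib)
  then have 1: "inner x s = 1" using assms by auto
  have "(norm s)\<^sup>2 = (\<Sum>v\<in>S. inner (b v) s)"
    by (simp add: power2_norm_eq_inner) (simp add: s_def inner_sum_left)
  then have "(norm s)\<^sup>2 = real (card S)"
    by (simp add: ib)
  moreover have "1 \<le> norm x * norm s"
    using norm_cauchy_schwarz[of x s] 1 by simp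
  then have "1 \<le> (norm x * norm s)\<^sup>2"
    by (simp add: one_le_power)
  ultimately have "1 \<le> (norm x)\<^sup>2 * real (card S)"
    by (simp add: power_mult_distrib)
  also have "\<dots> \<le> (norm x)\<^sup>2 * real N"
    using assms by (intro mult_left_mono) auto
  finally show ?thesis by (simp add: mult.commute)
qed

end

lemma norm_sum_orthogonal:
  fixes v :: "nat \<Rightarrow> 'h::real_inner"
  assumes "finite I" and "\<And>i j. i \<in> I \<Longrightarrow> j \<in> I \<Longrightarrow> i \<noteq> j \<Longrightarrow> inner (v i) (v j) = 0"
  shows "(norm (\<Sum>i\<in>I. v i))\<^sup>2 = (\<Sum>i\<in>I. (norm (v i))\<^sup>2)"
proof -
  have "(norm (\<Sum>i\<in>I. v i))\<^sup>2 = (\<Sum>i\<in>I. \<Sum>j\<in>I. inner (v i) (v j))"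
    unfolding power2_norm_eq_inner inner_sum_left inner_sum_right by (rule sum.swap)
  also have "\<dots> = (\<Sum>i\<in>I. \<Sum>j\<in>I. if i = j then (norm (v i))\<^sup>2 else 0)"
    using assms by (intro sum.cong) (auto simp: power2_norm_eq_inner)
  finally show ?thesis using assms by simp
qed

section \<open>The random descent and its embedding\<close>

text \<open>Hyperbolicity enters only through \<open>fellow\<close>, where \<open>r\<close> and
  \<open>s\<close> may differ so that points of different levels can be compared. The radius
  \<open>2 * \<Delta>\<close> bounds how far the descent strays from the tree path.\<close>

locale rooted_hyperbolic = orthonormal_family X b + spanning_tree X d root par
  for X :: "'a set" and b :: "'a \<Rightarrow> 'h::real_inner" and d root par +
  fixes \<Delta> N :: nat
  assumes fellow: "\<And>x y i r s. x \<in> X \<Longrightarrow> y \<in> X \<Longrightarrow> d root x = i + r \<Longrightarrow> d root y = i + s \<Longrightarrow>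
                   d x y + \<Delta> \<le> r \<Longrightarrow> d ((par ^^ r) x) ((par ^^ s) y) \<le> \<Delta>"
    and ball_finite: "\<And>x. x \<in> X \<Longrightarrow> finite {y \<in> X. d x y \<le> 2 * \<Delta>}"
    and ball_card: "\<And>x. x \<in> X \<Longrightarrow> card {y \<in> X. d x y \<le> 2 * \<Delta>} \<le> N"
    and \<Delta>_pos: "\<Delta> > 0"
begin

text \<open>If two points of a common level are within \<open>\<Delta>\<close>, moving each by at
  most \<open>\<Delta>\<close> leaves them within \<open>3 * \<Delta>\<close>. A jump of
  \<open>3 * \<Delta> + \<Delta>\<close> levels is what \<open>fellow\<close> requires to bring them
  back to within \<open>\<Delta>\<close>.\<close>

definition R :: nat where "R = 4 * \<Delta>"

definition nb :: "'a \<Rightarrow> 'a set" where "nb u = {v \<in> X. lev v = lev u \<and> d u v \<le> \<Delta>}"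

lemma R_pos: "R > 0" using \<Delta>_pos by (simp add: R_def)

lemma anc_same_level:
  assumes "x \<in> X" "y \<in> X" "lev x = lev y" "d x y \<le> 3 * \<Delta>"
  shows "d (anc R x) (anc R y) \<le> \<Delta>"
proof (cases "lev x \<le> R")
  case True
  then have "anc R x = root" by (rule anc_root[OF assms(1)])
  moreover have "anc R y = root" using True assms(3) by (intro anc_root[OF assms(2)]) simp
  ultimately show ?thesis using root by (simp only: d_self)
next
  case False
  then show ?thesis
    by (intro fellow[of x y "lev x - R" R R] assms) (use assms in \<open>simp_all add: R_def\<close>)
qed

lemma nb_self: "u \<in> X \<Longrightarrow> u \<in> nb u"
  by (simp add: nb_def)

lemma nb_subset: "nb u \<subseteq> X"
  by (auto simp: nb_def)

lemma nb_finite: "u \<in> X \<Longrightarrow> finite (nb u)"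
  by (rule finite_subset[OF _ ball_finite]) (auto simp: nb_def)

lemma nb_card: "u \<in> X \<Longrightarrow> card (nb u) \<le> N"
  by (rule order_trans[OF card_mono[OF ball_finite] ball_card]) (auto simp: nb_def)

lemma N_pos: "N > 0"
  using nb_card[OF root] nb_self[OF root] nb_finite[OF root] by (cases N) auto

text \<open>The distribution of the random descent from \<open>z\<close> after \<open>k\<close>
  jumps, with \<open>b v\<close> for the unit mass at \<open>v\<close>. The recursion conditions on
  the first jump, so that an induction on \<open>k\<close> can vary the starting point.\<close>

primrec g :: "nat \<Rightarrow> 'a \<Rightarrow> 'h" where
  "g 0 z = b z"
| "g (Suc k) z = (1 / card (nb (anc R z))) *\<^sub>R (\<Sum>w\<in>nb (anc R z). g k w)"

text \<open>Independent uniform choices from two neighbourhoods of at most \<open>N\<close> points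
  both hit a given common point with probability at least \<open>1 / N^2\<close>.\<close>

definition l :: real where "l = 1 - 1 / (real N)\<^sup>2"

lemma l_bounds: "0 \<le> l" "l < 1"
  using N_pos by (auto simp: l_def)

lemma nb_pair:
  assumes "u \<in> X" "u' \<in> X" "lev u = lev u'" "d u u' \<le> \<Delta>" "w \<in> nb u" "w' \<in> nb u'"
  shows "lev w = lev w'" "d w w' \<le> 3 * \<Delta>"
  using assms d_tri[of w u w'] d_tri[of u u' w'] d_sym[of w u] by (auto simp: nb_def)

text \<open>After the jump the ancestors \<open>u\<close> and \<open>u'\<close> are within
  \<open>\<Delta>\<close>, so \<open>u'\<close> lies in both neighbourhoods and is the common point
  of the coupling. All other pairs satisfy the hypotheses again, so each jump gains a factor
  \<open>l\<close>.\<close>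

lemma g_contract:
  assumes "z \<in> X" "z' \<in> X" "lev z = lev z'" "d z z' \<le> 3 * \<Delta>"
  shows "norm (g k z - g k z') \<le> 2 * l ^ k"
  using assms
proof (induction k arbitrary: z z')
  case 0
  then have "norm (b z) = 1" "norm (b z') = 1"
    by (auto simp: norm_eq_sqrt_inner orthonormal)
  then show ?case using norm_triangle_ineq4[of "b z" "b z'"] by simp
next
  case (Suc k)
  define u u' where "u = anc R z" and "u' = anc R z'"
  have u: "u \<in> X" "u' \<in> X" "lev u = lev u'" "d u u' \<le> \<Delta>"
    using Suc.prems anc_same_level by (auto simp: u_def u'_def anc_in anc_lev)
  have "norm (g (Suc k) z - g (Suc k) z') \<le> (1 - 1 / (real N)\<^sup>2) * (2 * l ^ k)"
    unfolding g.simps u_def[symmetric] u'_def[symmetric]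
  proof (rule norm_average_diff_le)
    show "u' \<in> nb u" "u' \<in> nb u'" using u by (auto simp: nb_def)
    fix w w' assume "w \<in> nb u" "w' \<in> nb u'"
    then show "norm (g k w - g k w') \<le> 2 * l ^ k"
      using nb_pair[OF u] subsetD[OF nb_subset] by (intro Suc.IH) auto
  qed (use u nb_finite nb_card l_bounds in auto)
  then show ?case by (simp add: l_def mult_ac)
qed

section \<open>Supports of the distributions\<close>

definition supp :: "nat \<Rightarrow> 'a \<Rightarrow> 'a set" where
  "supp k z = {v. ((\<lambda>z w. w \<in> nb (anc R z)) ^^ k) z v}"

lemma g_in_hull: "z \<in> X \<Longrightarrow> g k z \<in> convex hull (b ` supp k z)"
proof (induction k arbitrary: z)
  case 0
  then show ?case by (simp add: supp_def)
next
  case (Suc k)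
  show ?case
    unfolding g.simps
  proof (rule average_mem_convex)
    fix w assume w: "w \<in> nb (anc R z)"
    then have "supp k w \<subseteq> supp (Suc k) z"
      \<comment> \<open>The relational power is split at the first jump here, to match the recursion
        of \<open>g\<close>; in \<open>supp_near\<close> it is split at the last.\<close>
      unfolding supp_def by (auto intro: relpowp_Suc_I2 simp del: relpowp.simps)
    then show "g k w \<in> convex hull (b ` supp (Suc k) z)"
      using Suc.IH[of w] w nb_subset hull_mono[of "b ` supp k w" "b ` supp (Suc k) z"] by blast
  qed (use Suc.prems nb_finite nb_self anc_in in blast)+
qed

text \<open>Deviations from the tree path do not accumulate: a jump shrinks a deviation of
  \<open>2 * \<Delta>\<close> to \<open>\<Delta>\<close>, and the move after it adds at most
  \<open>\<Delta>\<close> again.\<close>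

lemma supp_near:
  assumes "z \<in> X" "v \<in> supp k z"
  shows "v \<in> X \<and> lev v = lev z - k * R \<and> d (anc (k * R) z) v \<le> 2 * \<Delta>"
  using assms(2)
proof (induction k arbitrary: v)
  case 0
  then show ?case using assms(1) by (simp add: supp_def)
next
  case (Suc k)
  then obtain w where w: "w \<in> supp k z" "v \<in> nb (anc R w)"
    unfolding supp_def by (auto elim: relpowp_Suc_E)
  note IH = Suc.IH[OF w(1)]
  let ?u = "anc (k * R) z"
  have u: "?u \<in> X" "lev ?u = lev w" using IH assms by (auto simp: anc_in anc_lev)
  have "d (anc R ?u) (anc R w) \<le> \<Delta>"
    using u IH by (intro anc_same_level) auto
  moreover have "d (anc R w) v \<le> \<Delta>" "v \<in> X" "lev v = lev w - R"
    using w(2) IH by (auto simp: nb_def anc_lev)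
  moreover have "anc R ?u = anc (Suc k * R) z"
    by (simp add: funpow_add)
  ultimately show ?case
    using d_tri[of "anc R ?u" "anc R w" v] u IH anc_in[of ?u R] anc_in[of w R]
    by (auto simp del: funpow.simps)
qed

lemma supp_subset: "z \<in> X \<Longrightarrow> supp k z \<subseteq> X"
  using supp_near by blast

lemma supp_subset_ball: "z \<in> X \<Longrightarrow> supp k z \<subseteq> {v \<in> X. d (anc (k * R) z) v \<le> 2 * \<Delta>}"
  using supp_near by blast

lemma supp_finite: "z \<in> X \<Longrightarrow> finite (supp k z)"
  by (rule finite_subset[OF supp_subset_ball ball_finite[OF anc_in]])

lemma supp_card: "z \<in> X \<Longrightarrow> card (supp k z) \<le> N"
  by (rule order_trans[OF card_mono[OF ball_finite[OF anc_in] supp_subset_ball] ball_card[OF anc_in]])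

lemma g_norm_le: "z \<in> X \<Longrightarrow> norm (g k z) \<le> 1"
  using norm_hull_le[OF supp_subset g_in_hull] .

lemma g_norm_ge: "z \<in> X \<Longrightarrow> 1 \<le> real N * (norm (g k z))\<^sup>2"
  using norm_hull_ge[OF supp_subset supp_finite supp_card g_in_hull] .

text \<open>Each support lies on a single level and within \<open>2 * \<Delta>\<close> of the tree
  ancestor, so either alternative makes the supports disjoint.\<close>

lemma g_orthogonal:
  assumes "z \<in> X" "z' \<in> X"
    "lev z - k * R \<noteq> lev z' - k' * R \<or> d (anc (k * R) z) (anc (k' * R) z') > 4 * \<Delta>"
  shows "inner (g k z) (g k' z') = 0"
proof (rule inner_hull_disjoint[OF supp_subset supp_subset _ g_in_hull g_in_hull])
  have "False" if v: "v \<in> supp k z" "v \<in> supp k' z'" for v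
    using supp_near[OF assms(1) v(1)] supp_near[OF assms(2) v(2)] assms
      d_tri[of "anc (k * R) z" v "anc (k' * R) z'"] d_sym[of v "anc (k' * R) z'"]
    by (auto simp: anc_in)
  then show "supp k z \<inter> supp k' z' = {}" by blast
qed (use assms in auto)

text \<open>Rounding the level down to a multiple of \<open>R\<close> and then descending one more jump leaves room for
  the fellow travelling of neighbours; for \<open>lev x < R\<close> the truncated subtraction gives the root, but
  then the sum in \<open>emb\<close> is empty.\<close>

definition start :: "'a \<Rightarrow> 'a" where "start x = anc (lev x mod R + R) x"

lemma start_in: "x \<in> X \<Longrightarrow> start x \<in> X"
  by (simp add: start_def anc_in)

lemma start_lev: "x \<in> X \<Longrightarrow> lev (start x) = (lev x div R - 1) * R"
proof -
  have "lev x - (lev x mod R + R) = (lev x div R) * R - R"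
    using div_mult_mod_eq[of "lev x" R] by linarith
  then show "x \<in> X \<Longrightarrow> lev (start x) = (lev x div R - 1) * R"
    by (simp add: start_def anc_lev diff_mult_distrib)
qed

lemma g_start_orthogonal:
  assumes "x \<in> X" "k < lev x div R" "k' < lev x div R" "k \<noteq> k'"
  shows "inner (g k (start x)) (g k' (start x)) = 0"
proof (rule g_orthogonal)
  \<comment> \<open>With \<open>n = lev x div R\<close>, the level reached is
    \<open>(n - 1 - k) * R\<close>. As \<open>k < n\<close>, nothing is truncated and distinct
    \<open>k\<close> give distinct levels.\<close>
  have "lev x div R - 1 - k \<noteq> lev x div R - 1 - k'" using assms by linarith
  then show "lev (start x) - k * R \<noteq> lev (start x) - k' * R \<or>
      d (anc (k * R) (start x)) (anc (k' * R) (start x)) > 4 * \<Delta>"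
    using R_pos assms by (simp add: start_lev flip: diff_mult_distrib)
qed (use assms start_in in auto)

text \<open>The number of summands is such that the last one lies at level 0, where the distribution
  is the unit mass at the root.\<close>

definition emb :: "real \<Rightarrow> 'a \<Rightarrow> 'h" where
  "emb \<beta> x = (\<Sum>k<lev x div R. real (Suc k) powr \<beta> *\<^sub>R g k (start x))"

section \<open>The Lipschitz bound\<close>

lemma lev_lipschitz: "x \<in> X \<Longrightarrow> y \<in> X \<Longrightarrow> lev x \<le> lev y + d x y"
  using d_tri[of root y x] d_sym[of x y] root by auto

lemma weighted_sum_le:
  assumes "\<beta> \<le> 1" and "\<And>k. k < n \<Longrightarrow> norm (v k) \<le> 2 * l ^ k"
  shows "norm (\<Sum>k<n. real (Suc k) powr \<beta> *\<^sub>R v k) \<le> 2 * (\<Sum>k. real (Suc k) powr \<beta> * l ^ k)"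
proof -
  have "norm (\<Sum>k<n. real (Suc k) powr \<beta> *\<^sub>R v k) \<le> (\<Sum>k<n. 2 * (real (Suc k) powr \<beta> * l ^ k))"
  proof (rule sum_norm_le)
    fix k assume "k \<in> {..<n}"
    then have "real (Suc k) powr \<beta> * norm (v k) \<le> real (Suc k) powr \<beta> * (2 * l ^ k)"
      using assms(2) by (intro mult_left_mono) auto
    then show "norm (real (Suc k) powr \<beta> *\<^sub>R v k) \<le> 2 * (real (Suc k) powr \<beta> * l ^ k)"
      by (simp add: mult_ac)
  qed
  also have "\<dots> \<le> 2 * (\<Sum>k. real (Suc k) powr \<beta> * l ^ k)"
    unfolding sum_distrib_left[symmetric]
    by (intro mult_left_mono sum_le_suminf summable_Suc_powr_mult_power)
      (use assms l_bounds in auto)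
  finally show ?thesis .
qed

text \<open>Both sums have the same number of terms and their starting points are close on a common
  level, so \<open>g_contract\<close> applies term by term.\<close>

lemma emb_same_block:
  assumes "x \<in> X" "y \<in> X" "d x y \<le> 1" "lev x div R = lev y div R" "\<beta> \<le> 1"
  shows "dist (emb \<beta> x) (emb \<beta> y) \<le> 2 * (\<Sum>k. real (Suc k) powr \<beta> * l ^ k)"
proof -
  define n where "n = lev x div R"
  have "norm (g k (start x) - g k (start y)) \<le> 2 * l ^ k" if "k < n" for k
  proof (rule g_contract)
    \<comment> \<open>\<open>k < n\<close> ensures \<open>n > 0\<close>, so \<open>n - 1\<close> is
      a genuine predecessor.\<close>
    have "n * R = (n - 1) * R + R" using that by (cases n) auto
    then have "lev x = (n - 1) * R + (lev x mod R + R)" "lev y = (n - 1) * R + (lev y mod R + R)"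
      using div_mult_mod_eq[of "lev x" R] div_mult_mod_eq[of "lev y" R]
      unfolding assms(4)[symmetric] n_def[symmetric] by linarith+
    moreover have "d x y + \<Delta> \<le> lev x mod R + R"
      using assms(3) \<Delta>_pos by (simp add: R_def)
    ultimately have "d (start x) (start y) \<le> \<Delta>"
      unfolding start_def by (intro fellow[OF assms(1,2)])
    then show "d (start x) (start y) \<le> 3 * \<Delta>" by simp
  qed (use assms start_in start_lev in auto)
  then have "norm (\<Sum>k<n. real (Suc k) powr \<beta> *\<^sub>R (g k (start x) - g k (start y)))
      \<le> 2 * (\<Sum>k. real (Suc k) powr \<beta> * l ^ k)"
    by (intro weighted_sum_le assms(5))
  then show ?thesis
    using assms(4) by (simp add: emb_def n_def dist_norm sum_subtractf scaleR_diff_right)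
qed

text \<open>Here \<open>\<beta> < 1 / 2\<close> is decisive: it puts the exponent below -1.\<close>

lemma summable_Suc_powr:
  assumes "\<beta> < 1 / 2"
  shows "summable (\<lambda>k. real (Suc k) powr (2 * \<beta> - 2))"
proof -
  have "summable (\<lambda>k. real k powr (2 * \<beta> - 2))"
    using assms by (subst summable_real_powr_iff) auto
  then show ?thesis by (subst summable_Suc_iff)
qed

text \<open>\<open>y\<close> has one summand more, so its indices are shifted by one to match
  levels. What remains is its first summand, of norm at most 1, the change of weights
  \<open>T\<close>, and the difference \<open>W\<close> of the distributions with equal weights,
  which contracts.\<close>

lemma emb_next_block:
  assumes x: "x \<in> X" and y: "y \<in> X" and "d x y \<le> 1" "lev y div R = Suc (lev x div R)" "0 \<le> \<beta>" "\<beta> < 1 / 2"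
  shows "dist (emb \<beta> y) (emb \<beta> x) \<le>
    1 + sqrt (\<Sum>k. real (Suc k) powr (2 * \<beta> - 2)) + 2 * (\<Sum>k. real (Suc k) powr \<beta> * l ^ k)"
proof -
  define n where "n = lev x div R"
  have ny: "lev y div R = Suc n" using assms by (simp add: n_def)
  have lx: "lev x = n * R + lev x mod R" and ly: "lev y = Suc n * R + lev y mod R"
    using div_mult_mod_eq[of "lev x" R] div_mult_mod_eq[of "lev y" R] ny by (simp_all add: n_def)
  define D where "D k = real (Suc (Suc k)) powr \<beta> - real (Suc k) powr \<beta>" for k
  define T where "T = (\<Sum>k<n. D k *\<^sub>R g (Suc k) (start y))"
  define W where "W = (\<Sum>k<n. real (Suc k) powr \<beta> *\<^sub>R (g (Suc k) (start y) - g k (start x)))"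
  have "emb \<beta> y = g 0 (start y) + (\<Sum>k<n. real (Suc (Suc k)) powr \<beta> *\<^sub>R g (Suc k) (start y))"
    unfolding emb_def ny by (subst sum.lessThan_Suc_shift) simp
  then have split: "emb \<beta> y - emb \<beta> x = g 0 (start y) + T + W"
    unfolding T_def W_def D_def emb_def n_def[symmetric]
    by (simp add: sum_subtractf scaleR_diff_right scaleR_diff_left del: g.simps of_nat_Suc)

  \<comment> \<open>The summands of \<open>T\<close> lie on distinct levels, so their squared norms
    add up. The triangle inequality would instead lead to the divergent sum of
    \<open>(k + 1) powr (\<beta> - 1)\<close>.\<close>
  have "(norm T)\<^sup>2 = (\<Sum>k<n. (norm (D k *\<^sub>R g (Suc k) (start y)))\<^sup>2)"
    unfolding T_def using y ny by (intro norm_sum_orthogonal) (auto simp: g_start_orthogonal simp del: g.simps)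
  also have "\<dots> \<le> (\<Sum>k<n. real (Suc k) powr (2 * \<beta> - 2))"
  proof (rule sum_mono)
    fix k
    have "norm (D k *\<^sub>R g (Suc k) (start y)) \<le> \<bar>D k\<bar> * 1"
      unfolding norm_scaleR by (intro mult_left_mono g_norm_le start_in y) auto
    also have "\<dots> \<le> real (Suc k) powr (\<beta> - 1)"
      unfolding D_def using assms by (simp add: Suc_powr_diff_le del: of_nat_Suc)
    finally have "(norm (D k *\<^sub>R g (Suc k) (start y)))\<^sup>2 \<le> (real (Suc k) powr (\<beta> - 1))\<^sup>2"
      by (intro power_mono) auto
    also have "\<dots> = real (Suc k) powr (2 * \<beta> - 2)"
      by (simp add: power2_eq_square flip: powr_add)
    finally show "(norm (D k *\<^sub>R g (Suc k) (start y)))\<^sup>2 \<le> real (Suc k) powr (2 * \<beta> - 2)" .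
  qed
  also have "\<dots> \<le> (\<Sum>k. real (Suc k) powr (2 * \<beta> - 2))"
    by (intro sum_le_suminf summable_Suc_powr assms) auto
  finally have T: "norm T \<le> sqrt (\<Sum>k. real (Suc k) powr (2 * \<beta> - 2))"
    by (simp add: real_le_rsqrt)
  have W: "norm W \<le> 2 * (\<Sum>k. real (Suc k) powr \<beta> * l ^ k)"
    unfolding W_def
  proof (rule weighted_sum_le)
    fix k assume k: "k < n"
    \<comment> \<open>The centre of the neighbourhood over which \<open>g (Suc k) (start y)\<close>
      averages. It is reached from \<open>y\<close> by \<open>lev y mod R + 2 * R\<close> steps to
      the parent and shares the level of \<open>start x\<close>.\<close>
    define u where "u = anc R (start y)"
    have u: "u \<in> X" using y by (simp add: u_def anc_in start_in)
    have n: "n > 0" using k by simp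
    have l1: "lev x = (n - 1) * R + (lev x mod R + R)"
      using lx n by (cases n) auto
    have l2: "lev y = (n - 1) * R + (lev y mod R + 2 * R)"
      using ly n by (cases n) auto
    have "u = anc (lev y mod R + 2 * R) y"
      unfolding u_def start_def mult_2 by (simp only: funpow_add o_apply add.commute add.left_commute)
    then have ux: "d u (start x) \<le> \<Delta>"
      unfolding start_def
      using fellow[OF y x l2 l1] assms d_sym[of x y] \<Delta>_pos by (auto simp: R_def)
    have lu: "lev u = lev (start x)"
      using x y ny by (simp add: u_def anc_lev start_in start_lev n_def[symmetric] diff_mult_distrib)
    have sx: "start x \<in> X" using x by (rule start_in)
    \<comment> \<open>The ball is convex, so it suffices to place each averaged vector
      \<open>g k w\<close> in it.\<close>
    let ?C = "cball (g k (start x)) (2 * l ^ k)"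
    have "g (Suc k) (start y) \<in> ?C"
      unfolding g.simps u_def[symmetric]
    proof (rule average_mem_convex)
      fix w assume "w \<in> nb u"
      then have "w \<in> X" "lev (start x) = lev w" "d (start x) w \<le> 3 * \<Delta>"
        using nb_pair[OF sx u lu[symmetric] _ nb_self[OF sx]] ux d_sym[OF u sx] nb_subset by auto
      then show "g k w \<in> ?C"
        using g_contract[OF sx] by (simp add: dist_norm)
    qed (use u nb_finite nb_self in auto)
    then show "norm (g (Suc k) (start y) - g k (start x)) \<le> 2 * l ^ k"
      by (simp only: mem_cball dist_norm norm_minus_commute)
  qed (use assms in auto)
  have "norm (g 0 (start y) + T + W) \<le> 1 + sqrt (\<Sum>k. real (Suc k) powr (2 * \<beta> - 2))
      + 2 * (\<Sum>k. real (Suc k) powr \<beta> * l ^ k)"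
    using g_norm_le[OF start_in[OF y], of 0] T W
    by (intro norm_triangle_le add_mono) auto
  then show ?thesis unfolding dist_norm split .
qed

text \<open>Along chains it is enough to treat points at distance 1. Their levels differ by at most
  1, so \<open>lev x div R\<close> and \<open>lev y div R\<close> are equal or consecutive.\<close>

lemma emb_lipschitz:
  assumes "0 \<le> \<beta>" "\<beta> < 1 / 2"
  shows "\<exists>L\<ge>0. \<forall>x\<in>X. \<forall>y\<in>X. dist (emb \<beta> x) (emb \<beta> y) \<le> L * real (d x y)"
proof -
  define s where "s = 2 * (\<Sum>k. real (Suc k) powr \<beta> * l ^ k)"
  define q where "q = sqrt (\<Sum>k. real (Suc k) powr (2 * \<beta> - 2))"
  define L where "L = 1 + q + s"
  have q: "q \<ge> 0" unfolding q_def
    by (intro real_sqrt_ge_zero suminf_nonneg summable_Suc_powr assms) auto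
  have s: "s \<ge> 0" unfolding s_def
    using assms l_bounds by (intro mult_nonneg_nonneg suminf_nonneg summable_Suc_powr_mult_power) auto
  have near: "dist (emb \<beta> x) (emb \<beta> y) \<le> L" if "x \<in> X" "y \<in> X" "d x y = 1" for x y
  proof -
    have "lev x \<le> lev y + 1" "lev y \<le> lev x + 1"
      using lev_lipschitz[OF that(1,2)] lev_lipschitz[OF that(2,1)] d_sym[OF that(1,2)] that(3) by simp_all
    then have "lev x div R \<le> (lev y + R) div R" "lev y div R \<le> (lev x + R) div R"
      by (intro div_le_mono; use R_pos in linarith)+
    then have "lev x div R \<le> Suc (lev y div R)" "lev y div R \<le> Suc (lev x div R)"
      using R_pos by simp_all
    then consider "lev x div R = lev y div R" | "lev x div R = Suc (lev y div R)" | "lev y div R = Suc (lev x div R)"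
      by linarith
    then show ?thesis
    proof cases
      case 1
      then show ?thesis
        using emb_same_block[OF that(1,2), of \<beta>, folded s_def] that(3) assms q
        unfolding L_def by linarith
    next
      case 2
      then show ?thesis
        using emb_next_block[OF that(2,1) _ _ assms, folded s_def q_def] that d_sym[OF that(1,2)]
        unfolding L_def by simp
    next
      case 3
      then show ?thesis
        using emb_next_block[OF that(1,2) _ _ assms, folded s_def q_def] that(3)
        unfolding L_def by (simp add: dist_commute)
    qed
  qed
  have "dist (emb \<beta> x) (emb \<beta> y) \<le> L * real n" if "x \<in> X" "y \<in> X" "d x y = n" for n x y
    using that
  proof (induction n arbitrary: y)
    case 0
    then show ?case using d_zero by auto
  next
    case (Suc n)
    then obtain z where z: "z \<in> X" "d x z = n" "d z y = 1" using d_chain by blast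
    have "dist (emb \<beta> x) (emb \<beta> y) \<le> dist (emb \<beta> x) (emb \<beta> z) + dist (emb \<beta> z) (emb \<beta> y)"
      by (rule dist_triangle)
    also have "\<dots> \<le> L * real n + L"
      using Suc.IH[OF Suc.prems(1) z(1,2)] near[OF z(1) Suc.prems(2) z(3)] by (rule add_mono)
    finally show ?case by (simp add: distrib_left)
  qed
  then have "\<forall>x\<in>X. \<forall>y\<in>X. dist (emb \<beta> x) (emb \<beta> y) \<le> L * d x y"
    by simp
  moreover have "L \<ge> 0" using q s by (simp add: L_def)
  ultimately show ?thesis by (intro exI[of _ L] conjI)
qed

section \<open>The lower bound\<close>

lemma emb_dist_ge_level:
  assumes x: "x \<in> X" and y: "y \<in> X" and "lev y \<le> lev x" "0 \<le> \<beta>"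
    and m: "d x y > 2 * ((m + 2) * R) + 4 * \<Delta>"
  shows "(real m / 2) powr (2 * \<beta> + 1) \<le> real N * (dist (emb \<beta> x) (emb \<beta> y))\<^sup>2"
proof -
  define n where "n = lev x div R"
  \<comment> \<open>The first \<open>m\<close> summands of \<open>emb \<beta> x\<close> turn out to
    be orthogonal to its other summands and to all of \<open>emb \<beta> y\<close>, so the distance
    is at least the norm of their sum.\<close>
  define V where "V = (\<Sum>k<m. real (Suc k) powr \<beta> *\<^sub>R g k (start x))"
  \<comment> \<open>A detour through the root costs at most \<open>2 * lev x\<close>, so
    \<open>x\<close> is deep enough to have at least \<open>m + 2\<close> summands.\<close>
  have "d x y \<le> 2 * lev x"
    using d_tri[OF x root y] d_sym[OF x root] assms by linarith
  then have lx: "(m + 2) * R \<le> lev x" using m by linarith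
  then have mn: "m + 2 \<le> n"
    using R_pos unfolding n_def by (simp add: less_eq_div_iff_mult_less_eq)
  have oxx: "inner (g k (start x)) (g k' (start x)) = 0" if "k < n" "k' < n" "k \<noteq> k'" for k k'
    using g_start_orthogonal[OF x] that by (simp add: n_def)
  have oxy: "inner (g k (start y)) (g k' (start x)) = 0" if "k < lev y div R" "k' < m" for k k'
  proof (cases "lev (start y) - k * R = lev (start x) - k' * R")
    case True
    let ?u = "anc (k' * R) (start x)" and ?v = "anc (k * R) (start y)"
    have uv: "?u \<in> X" "?v \<in> X" using x y by (auto simp: start_in anc_in)
    have u: "?u = anc (k' * R + (lev x mod R + R)) x" and v: "?v = anc (k * R + (lev y mod R + R)) y"
      by (simp_all add: start_def funpow_add)
    have k': "k' * R + R \<le> m * R"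
      using that by (metis Suc_leI add.commute mult_Suc mult_le_mono1)
    have mod: "lev x mod R < R" "lev y mod R < R" using R_pos by auto
    have mR: "(m + 2) * R = m * R + R + R" by (simp add: algebra_simps)
    have dx: "d x ?u \<le> (m + 2) * R"
      using anc_near[OF x, of "k' * R + (lev x mod R + R)"] k' mod unfolding u mR by linarith
    \<comment> \<open>As \<open>lev y \<le> lev x\<close>, the descent from \<open>y\<close> needs
      no more jumps than the one from \<open>x\<close> to reach the common level. Both tree paths
      thus have length at most \<open>(m + 2) * R\<close>, too short to bring \<open>x\<close> and
      \<open>y\<close> together.\<close>
    have "k * R + (lev y mod R + R) \<le> (m + 2) * R"
    proof -
      have "Suc k * R \<le> (lev y div R) * R" using that by (intro mult_le_mono1) simp
      then have ky: "k * R + R \<le> (lev y div R) * R" by simp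
      have "Suc k' * R \<le> (lev x div R) * R" using that mn by (intro mult_le_mono1) (simp add: n_def)
      then have kx: "k' * R + R \<le> (lev x div R) * R" by simp
      have ly: "lev (start y) = (lev y div R) * R - R" "lev (start x) = (lev x div R) * R - R"
        using x y by (simp_all add: start_lev diff_mult_distrib)
      have "(lev y div R) * R \<le> (lev x div R) * R"
        using assms by (intro mult_le_mono1 div_le_mono)
      then have "k * R \<le> k' * R"
        using True ky kx unfolding ly by linarith
      then show ?thesis using k' mod unfolding mR by linarith
    qed
    then have dy: "d y ?v \<le> (m + 2) * R"
      using anc_near[OF y, of "k * R + (lev y mod R + R)"] v by simp
    have "d x y \<le> d x ?u + (d ?u ?v + d ?v y)"
      using d_tri[of x ?u y] d_tri[of ?u ?v y] x y uv by simp
    then have "d ?v ?u > 4 * \<Delta>"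
      using m dx dy d_sym[of y ?v] d_sym[of ?u ?v] x y uv by simp
    then show ?thesis using x y by (intro g_orthogonal) (auto simp: start_in)
  qed (use x y in \<open>auto intro!: g_orthogonal simp: start_in\<close>)
  have "emb \<beta> x = V + (\<Sum>k\<in>{m..<n}. real (Suc k) powr \<beta> *\<^sub>R g k (start x))"
    unfolding emb_def V_def n_def[symmetric]
    using mn by (subst sum.union_disjoint[symmetric]) (auto intro!: sum.cong)
  moreover have "inner (\<Sum>k\<in>{m..<n}. real (Suc k) powr \<beta> *\<^sub>R g k (start x)) V = 0"
    unfolding V_def inner_sum_left inner_sum_right using mn
    by (auto intro!: sum.neutral simp: oxx simp del: of_nat_Suc)
  moreover have "inner (emb \<beta> y) V = 0"
    unfolding V_def emb_def inner_sum_left inner_sum_right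
    by (auto intro!: sum.neutral simp: oxy simp del: of_nat_Suc)
  ultimately have "inner (emb \<beta> x - emb \<beta> y) V = (norm V)\<^sup>2"
    by (simp add: inner_diff_left inner_left_distrib power2_norm_eq_inner)
  then have "norm V * norm V \<le> dist (emb \<beta> x) (emb \<beta> y) * norm V"
    using norm_cauchy_schwarz[of "emb \<beta> x - emb \<beta> y" V] by (simp add: dist_norm power2_eq_square)
  then have VD: "norm V \<le> dist (emb \<beta> x) (emb \<beta> y)"
    by (cases "norm V = 0") (auto simp: mult_le_cancel_right)
  have "(real m / 2) powr (2 * \<beta> + 1) \<le> (\<Sum>k<m. real (Suc k) powr (2 * \<beta>))"
    using assms by (intro sum_Suc_powr_ge) auto
  also have "\<dots> \<le> (\<Sum>k<m. real N * (norm (real (Suc k) powr \<beta> *\<^sub>R g k (start x)))\<^sup>2)"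
  proof (rule sum_mono)
    fix k
    have "real (Suc k) powr (2 * \<beta>) = (real (Suc k) powr \<beta>)\<^sup>2 * 1"
      by (simp add: power2_eq_square flip: powr_add)
    also have "\<dots> \<le> (real (Suc k) powr \<beta>)\<^sup>2 * (real N * (norm (g k (start x)))\<^sup>2)"
      by (intro mult_left_mono g_norm_ge start_in x) auto
    finally show "real (Suc k) powr (2 * \<beta>) \<le> real N * (norm (real (Suc k) powr \<beta> *\<^sub>R g k (start x)))\<^sup>2"
      by (simp add: power_mult_distrib mult.left_commute del: of_nat_Suc)
  qed
  also have "\<dots> = real N * (norm V)\<^sup>2"
    unfolding V_def sum_distrib_left[symmetric] using mn oxx by (subst norm_sum_orthogonal) auto
  also have "\<dots> \<le> real N * (dist (emb \<beta> x) (emb \<beta> y))\<^sup>2"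
    using VD by (intro mult_left_mono power_mono) auto
  finally show ?thesis .
qed

lemma emb_dist_ge:
  assumes "0 \<le> \<beta>"
  shows "\<exists>c>0. \<exists>M\<ge>0. \<forall>x\<in>X. \<forall>y\<in>X. real (d x y) \<ge> M \<longrightarrow>
           c * real (d x y) powr (\<beta> + 1 / 2) \<le> dist (emb \<beta> x) (emb \<beta> y)"
proof -
  define a where "a = \<beta> + 1 / 2"
  define c where "c = (1 / (32 * real R)) powr a / sqrt (real N)"
  have R: "real R \<ge> 4 * real \<Delta>" "real R > 0" using R_pos by (auto simp: R_def)
  have c: "c > 0" using R N_pos by (simp add: c_def)
  have "c * real (d x y) powr a \<le> dist (emb \<beta> x) (emb \<beta> y)"
    if xy: "x \<in> X" "y \<in> X" and M: "real (d x y) \<ge> 32 * real R" for x y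
  proof -
    \<comment> \<open>The threshold \<open>32 * R\<close> yields \<open>m \<ge> 4\<close>, and then
      the divisor \<open>8 * R\<close> leaves enough room for the distance hypothesis of
      \<open>emb_dist_ge_level\<close>.\<close>
    define m where "m = nat \<lfloor>real (d x y) / (8 * real R)\<rfloor>"
    have 0: "real (d x y) / (8 * real R) \<ge> 4" using M R(2) by (simp add: field_simps)
    have m: "real m \<le> real (d x y) / (8 * real R)" "real (d x y) / (8 * real R) < real m + 1"
      unfolding m_def using 0 of_nat_floor[of "real (d x y) / (8 * real R)"] by simp linarith
    have m4: "m \<ge> 4" using m 0 by linarith
    have "8 * real (m * R) \<le> real (d x y)" using m(1) R(2) by (simp add: field_simps)
    then have mm: "8 * (m * R) \<le> d x y" by linarith
    have "4 * R \<le> m * R" using m4 by (rule mult_le_mono1)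
    then have big: "d x y > 2 * ((m + 2) * R) + 4 * \<Delta>"
    proof -
      have "(m + 2) * R = m * R + R + R" by (simp add: algebra_simps)
      then show ?thesis using mm \<open>4 * R \<le> m * R\<close> R_pos R_def by linarith
    qed
    have "(real m / 2) powr (2 * \<beta> + 1) \<le> real N * (dist (emb \<beta> x) (emb \<beta> y))\<^sup>2"
    proof (cases "lev y \<le> lev x")
      case True
      then show ?thesis using emb_dist_ge_level[OF xy _ assms big] by blast
    next
      case False
      then show ?thesis
        using emb_dist_ge_level[OF xy(2,1) _ assms, of m] big d_sym[OF xy] by (simp add: dist_commute)
    qed
    moreover have "(real m / 2) powr (2 * \<beta> + 1) = ((real m / 2) powr a)\<^sup>2"
      by (simp add: power2_eq_square a_def flip: powr_add)
    ultimately have "((real m / 2) powr a)\<^sup>2 \<le> real N * (dist (emb \<beta> x) (emb \<beta> y))\<^sup>2"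
      by simp
    then have "sqrt (((real m / 2) powr a)\<^sup>2) \<le> sqrt (real N * (dist (emb \<beta> x) (emb \<beta> y))\<^sup>2)"
      by (rule real_sqrt_le_mono)
    then have 1: "(real m / 2) powr a \<le> sqrt (real N) * dist (emb \<beta> x) (emb \<beta> y)"
      by (simp add: real_sqrt_mult)
    \<comment> \<open>A quotient of at least 4 loses at most half of its value in rounding down; the
      other factor 2 is that of \<open>m / 2\<close>.\<close>
    have "real (d x y) / (32 * real R) = (real (d x y) / (8 * real R)) / 4"
      by simp
    then have "real (d x y) / (32 * real R) \<le> real m / 2"
      using m(2) 0 by linarith
    then have "(real (d x y) / (32 * real R)) powr a \<le> (real m / 2) powr a"
      using assms R by (intro powr_mono2) (auto simp: a_def)
    also have "(real (d x y) / (32 * real R)) powr a = (1 / (32 * real R)) powr a * real (d x y) powr a"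
      using R by (simp add: powr_divide)
    finally have "(1 / (32 * real R)) powr a * real (d x y) powr a \<le> sqrt (real N) * dist (emb \<beta> x) (emb \<beta> y)"
      using 1 by linarith
    then show ?thesis
      using N_pos by (simp add: c_def field_simps)
  qed
  then show ?thesis
    using c R unfolding a_def by (intro exI[of _ c] conjI exI[of _ "32 * real R"]) auto
qed

end

section \<open>Compression exponents\<close>

lemma compression_exponentI:
  fixes f :: "'a \<Rightarrow> 'h::{real_inner, complete_space}"
  assumes "0 < \<alpha>" "0 \<le> L" "0 < c" "0 \<le> M"
    and upper: "\<And>x y. x \<in> X \<Longrightarrow> y \<in> X \<Longrightarrow> dist (f x) (f y) \<le> L * d x y"
    and lower: "\<And>x y. x \<in> X \<Longrightarrow> y \<in> X \<Longrightarrow> M \<le> d x y \<Longrightarrow> c * d x y powr \<alpha> \<le> dist (f x) (f y)"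
  shows "compression_exponent X d TYPE('h) \<alpha>"
proof -
  \<comment> \<open>The lower estimate is available only from \<open>M\<close> on; below
    \<open>M\<close> the value 0 is a trivial bound and keeps the function monotone.\<close>
  define \<rho> where "\<rho> t = (if t < M then 0 else c * t powr \<alpha>)" for t
  have "uniform_embedding X d f"
    unfolding uniform_embedding_def
  proof (rule exI[of _ \<rho>], rule exI[of _ "\<lambda>t. L * t"], intro conjI ballI)
    show "mono_on {0..} \<rho>"
      using assms by (intro mono_onI) (auto simp: \<rho>_def intro!: mult_left_mono powr_mono2)
    show "mono_on {0..} (\<lambda>t. L * t)"
      using assms by (intro mono_onI mult_left_mono) auto
    have "filterlim (\<lambda>t. c * exp (\<alpha> * ln t)) at_top at_top"
      using assms(1,3)
      by (intro filterlim_tendsto_pos_mult_at_top[OF tendsto_const] filterlim_compose[OF exp_at_top] ln_at_top)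
    moreover have "eventually (\<lambda>t. c * exp (\<alpha> * ln t) = \<rho> t) at_top"
      using eventually_ge_at_top[of M] eventually_gt_at_top[of 0]
      by eventually_elim (simp add: \<rho>_def powr_def)
    ultimately show "filterlim \<rho> at_top at_top"
      by (rule filterlim_mono_eventually[OF _ order_refl order_refl])
    fix x y assume xy: "x \<in> X" "y \<in> X"
    show "\<rho> (d x y) \<le> dist (f x) (f y)"
      using lower[OF xy] by (simp add: \<rho>_def)
    show "dist (f x) (f y) \<le> L * d x y" by (rule upper[OF xy])
  qed (use assms in \<open>auto simp: \<rho>_def\<close>)
  moreover have "(\<lambda>t. ennreal (t powr \<alpha>)) \<preceq> compression X d f"
    unfolding asymp_le_def
  proof (rule exI[of _ "1 / c"], rule conjI, goal_cases)
    case 2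
    show ?case
    proof (rule exI[of _ M], intro allI impI)
    fix t assume t: "M \<le> t"
    have "ennreal (c * t powr \<alpha>) \<le> compression X d f t"
      unfolding compression_def
    \<comment> \<open>If no pair is at distance at least \<open>t\<close>, the infimum is infinite
      and the condition is vacuous.\<close>
    proof (rule Inf_greatest)
      fix z assume "z \<in> {ennreal (dist (f x) (f y)) |x y. x \<in> X \<and> y \<in> X \<and> t \<le> d x y}"
      then obtain x y where xy: "z = ennreal (dist (f x) (f y))" "x \<in> X" "y \<in> X" "t \<le> d x y" by blast
      have "c * t powr \<alpha> \<le> c * d x y powr \<alpha>"
        using xy t assms by (intro mult_left_mono powr_mono2) auto
      also have "\<dots> \<le> dist (f x) (f y)" using lower xy t by simp
      finally show "ennreal (c * t powr \<alpha>) \<le> z" by (simp add: xy(1) ennreal_leI)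
    qed
    then have "ennreal (1 / c) * ennreal (c * t powr \<alpha>) \<le> ennreal (1 / c) * compression X d f t"
      by (rule mult_left_mono) simp
    then show "ennreal (t powr \<alpha>) \<le> ennreal (1 / c) * compression X d f t"
      using assms by (simp flip: ennreal_mult')
    qed
  qed (use assms in simp)
  ultimately show ?thesis unfolding compression_exponent_def by blast
qed

lemma orthonormal_family_ell2:
  assumes "countable X"
  shows "\<exists>b :: 'a \<Rightarrow> ell2. orthonormal_family X b"
proof -
  define e where "e v = Abs_ell2 (\<lambda>n. if n = to_nat_on X v then 1 else 0)" for v
  have "summable (\<lambda>n. (if n = to_nat_on X v then 1 else 0 :: real)\<^sup>2)" for v
    by (rule summable_finite[of "{to_nat_on X v}"]) auto
  then have e: "ell2_nth (e v) = (\<lambda>n. if n = to_nat_on X v then 1 else 0)" for v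
    unfolding e_def by (simp add: Abs_ell2_inverse)
  have "inner (e v) (e w) = (if v = w then 1 else 0)" if "v \<in> X" "w \<in> X" for v w
  proof -
    have "inner (e v) (e w) = (\<Sum>n\<in>{to_nat_on X v}. ell2_nth (e v) n * ell2_nth (e w) n)"
      unfolding inner_ell2.rep_eq by (rule suminf_finite) (auto simp: e)
    then show ?thesis using that assms by (simp add: e)
  qed
  then show ?thesis by (intro exI[of _ e]) (unfold_locales, blast)
qed

section \<open>Word metrics\<close>

locale generated_group = group G for G (structure) +
  fixes S
  assumes finite_generators: "finite S" and generators_in: "S \<subseteq> carrier G"
    and generates: "generate G S = carrier G"
begin

abbreviation letters :: "'a set" where "letters \<equiv> S \<union> (\<lambda>s. inv s) ` S"

abbreviation word :: "'a list \<Rightarrow> 'a" where "word ws \<equiv> foldr (\<lambda>a b. a \<otimes> b) ws \<one>"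

abbreviation len :: "'a \<Rightarrow> nat" where "len \<equiv> word_length G S"

text \<open>The word metric with values in the natural numbers, as \<open>graph_metric\<close>
  requires.\<close>

definition wdist :: "'a \<Rightarrow> 'a \<Rightarrow> nat" where "wdist g h = len (inv g \<otimes> h)"

lemma letters_in: "letters \<subseteq> carrier G"
  using generators_in by auto

lemma word_in: "set ws \<subseteq> letters \<Longrightarrow> word ws \<in> carrier G"
  using letters_in by (induction ws) auto

lemma word_append:
  "set us \<subseteq> letters \<Longrightarrow> set vs \<subseteq> letters \<Longrightarrow> word (us @ vs) = word us \<otimes> word vs"
proof (induction us)
  case (Cons a us)
  then have "a \<in> carrier G" using letters_in by auto
  then show ?case using Cons word_in by (simp add: m_assoc)
qed (simp add: word_in)

lemma inv_letter: "s \<in> letters \<Longrightarrow> inv s \<in> letters"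
  using generators_in by auto

lemma inv_letters: "set ws \<subseteq> letters \<Longrightarrow> set (rev (map (\<lambda>s. inv s) ws)) \<subseteq> letters"
  unfolding set_rev set_map by (rule image_subsetI, rule inv_letter) blast

lemma word_inv: "set ws \<subseteq> letters \<Longrightarrow> word (rev (map (\<lambda>s. inv s) ws)) = inv (word ws)"
proof (induction ws)
  case (Cons a ws)
  have a: "a \<in> carrier G" using Cons.prems letters_in by auto
  have l: "set (rev (map (\<lambda>s. inv s) ws)) \<subseteq> letters" "set [inv a] \<subseteq> letters"
    using inv_letters[of ws] inv_letters[of "[a]"] Cons.prems by simp_all
  have "word (rev (map (\<lambda>s. inv s) (a # ws))) = word (rev (map (\<lambda>s. inv s) ws)) \<otimes> word [inv a]"
    using word_append[OF l] by simp
  then show ?case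
    using Cons a word_in by (simp add: inv_mult_group)
qed simp

lemma word_exists:
  assumes "g \<in> carrier G"
  shows "\<exists>ws. set ws \<subseteq> letters \<and> word ws = g"
proof -
  have "g \<in> generate G S" using assms generates by simp
  then show ?thesis
  proof (induction rule: generate.induct)
    case one
    then show ?case by (intro exI[of _ "[]"]) simp
  next
    case (incl h)
    then show ?case using generators_in by (intro exI[of _ "[h]"]) auto
  next
    case (inv h)
    then show ?case using generators_in by (intro exI[of _ "[inv h]"]) auto
  next
    case (eng h1 h2)
    then obtain us vs where "set us \<subseteq> letters" "word us = h1" "set vs \<subseteq> letters" "word vs = h2" by blast
    then show ?case by (intro exI[of _ "us @ vs"]) (simp add: word_append del: foldr_append)
  qed
qed

lemma geodesic_word:
  assumes "g \<in> carrier G"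
  shows "\<exists>ws. length ws = len g \<and> set ws \<subseteq> letters \<and> word ws = g"
  unfolding word_length_def by (rule LeastI_ex) (use word_exists[OF assms] in blast)

lemma len_word: "set ws \<subseteq> letters \<Longrightarrow> len (word ws) \<le> length ws"
  unfolding word_length_def by (rule Least_le) blast

lemma len_eq_0: "g \<in> carrier G \<Longrightarrow> len g = 0 \<longleftrightarrow> g = \<one>"
  using geodesic_word[of g] len_word[of "[]"] by auto

lemma len_mult:
  assumes "g \<in> carrier G" "h \<in> carrier G"
  shows "len (g \<otimes> h) \<le> len g + len h"
proof -
  obtain us vs where "length us = len g" "set us \<subseteq> letters" "word us = g"
    "length vs = len h" "set vs \<subseteq> letters" "word vs = h"
    using geodesic_word assms by meson
  then show ?thesis
    using len_word[of "us @ vs"] word_append[of us vs] by simp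
qed

lemma len_inv_le: "g \<in> carrier G \<Longrightarrow> len (inv g) \<le> len g"
proof -
  assume "g \<in> carrier G"
  then obtain ws where ws: "length ws = len g" "set ws \<subseteq> letters" "word ws = g"
    using geodesic_word by meson
  from len_word[OF inv_letters[OF ws(2)]] show ?thesis
    unfolding word_inv[OF ws(2)] using ws by simp
qed

lemma len_inv: "g \<in> carrier G \<Longrightarrow> len (inv g) = len g"
  using len_inv_le[of g] len_inv_le[of "inv g"] by simp

lemma wdist_mult: "g \<in> carrier G \<Longrightarrow> h \<in> carrier G \<Longrightarrow> wdist g (g \<otimes> h) = len h"
  unfolding wdist_def by (simp add: m_assoc[symmetric])

lemma mult_inv_cancel: "g \<in> carrier G \<Longrightarrow> h \<in> carrier G \<Longrightarrow> g \<otimes> (inv g \<otimes> h) = h"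
  by (simp add: m_assoc[symmetric])

sublocale graph_metric "carrier G" wdist
proof
  fix x y assume xy: "x \<in> carrier G" "y \<in> carrier G"
  show "wdist x y = 0 \<longleftrightarrow> x = y"
    using xy mult_inv_cancel[of x y] by (auto simp: wdist_def len_eq_0)
  have "inv (inv x \<otimes> y) = inv y \<otimes> x" using xy by (simp add: inv_mult_group)
  then show "wdist x y = wdist y x"
    unfolding wdist_def using len_inv[of "inv x \<otimes> y"] xy by simp
  show "wdist x z \<le> wdist x y + wdist y z" if z: "z \<in> carrier G" for z
  proof -
    have "(inv x \<otimes> y) \<otimes> (inv y \<otimes> z) = inv x \<otimes> z"
      using xy z by (simp add: m_assoc mult_inv_cancel)
    then show ?thesis
      unfolding wdist_def using len_mult[of "inv x \<otimes> y" "inv y \<otimes> z"] xy z by simp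
  qed
next
  fix x y n assume xy: "x \<in> carrier G" "y \<in> carrier G" and n: "wdist x y = Suc n"
  obtain ws where ws: "length ws = Suc n" "set ws \<subseteq> letters" "word ws = inv x \<otimes> y"
    using geodesic_word[of "inv x \<otimes> y"] xy n unfolding wdist_def by auto
  \<comment> \<open>Removing the last letter of a geodesic word leads to the point before the
    end.\<close>
  then obtain us s where us: "ws = us @ [s]" "length us = n"
    by (metis length_Suc_conv_rev)
  have l: "set us \<subseteq> letters" "set [s] \<subseteq> letters" using ws us by auto
  note uc = word_in[OF l(1)] and sc = word_in[OF l(2)]
  define z where "z = x \<otimes> word us"
  have z: "z \<in> carrier G" using xy uc by (simp add: z_def)
  have "word ws = word us \<otimes> word [s]" unfolding us(1) by (rule word_append[OF l])
  then have y: "y = z \<otimes> word [s]"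
    using ws(3) mult_inv_cancel[OF xy] m_assoc[OF xy(1) uc sc] by (simp only: z_def)
  have 1: "wdist x z \<le> n" unfolding z_def wdist_mult[OF xy(1) uc] using len_word[OF l(1)] us by simp
  have 2: "wdist z y \<le> 1" unfolding y wdist_mult[OF z sc] using len_word[OF l(2)] by simp
  \<comment> \<open>The triangle inequality for \<open>z\<close> forces equality in the bounds
    \<open>1\<close> and \<open>2\<close>.\<close>
  have "inv x \<otimes> y = (inv x \<otimes> z) \<otimes> (inv z \<otimes> y)"
    using xy z by (simp add: m_assoc mult_inv_cancel)
  then have "wdist x y \<le> wdist x z + wdist z y"
    unfolding wdist_def using len_mult[of "inv x \<otimes> z" "inv z \<otimes> y"] xy z by simp
  then show "\<exists>z\<in>carrier G. wdist x z = n \<and> wdist z y = 1"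
    using 1 2 n z by (intro bexI[of _ z]) auto
qed

lemma cayley_edge_iff:
  assumes "x \<in> carrier G" "y \<in> carrier G"
  shows "cayley_edge G S x y \<longleftrightarrow> wdist x y = 1"
proof
  assume "cayley_edge G S x y"
  then obtain s where s: "s \<in> S" "x \<noteq> y" "y = x \<otimes> s \<or> x = y \<otimes> s" unfolding cayley_edge_def by blast
  have sG: "s \<in> carrier G" using s generators_in by auto
  have "len s \<le> 1" using len_word[of "[s]"] s sG by simp
  then have "wdist x y \<le> 1"
    using s(3) wdist_mult[OF assms(1) sG] wdist_mult[OF assms(2) sG] d_sym[OF assms] by auto
  moreover have "wdist x y \<noteq> 0" using d_zero[OF assms] s(2) by simp
  ultimately show "wdist x y = 1" by simp
next
  assume 1: "wdist x y = 1"
  then obtain ws where ws: "length ws = 1" "set ws \<subseteq> letters" "word ws = inv x \<otimes> y"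
    using geodesic_word[of "inv x \<otimes> y"] assms unfolding wdist_def by auto
  then obtain s where s: "ws = [s]" by (auto simp: length_Suc_conv)
  have sl: "s \<in> letters" using ws s by simp
  then have sG: "s \<in> carrier G" using letters_in by blast
  have y: "y = x \<otimes> s" using ws(3) mult_inv_cancel[OF assms] sG by (simp add: s)
  have "x \<noteq> y" using 1 d_zero[OF assms] by auto
  moreover have "\<exists>s\<in>S. y = x \<otimes> s \<or> x = y \<otimes> s"
    using sl
  proof
    \<comment> \<open>An inverse letter is an edge read in the opposite direction, the second
      alternative in \<open>cayley_edge\<close>.\<close>
    assume "s \<in> (\<lambda>s. inv s) ` S"
    then obtain t where t: "t \<in> S" "s = inv t" by blast
    have tG: "t \<in> carrier G" using t generators_in by auto
    then have "x = y \<otimes> t" unfolding y t(2) using assms by (simp add: m_assoc)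
    then show ?thesis using t by blast
  qed (use y in blast)
  ultimately show "cayley_edge G S x y" by (simp add: cayley_edge_def)
qed

text \<open>The points of a ball are \<open>x\<close> times words of length at most
  \<open>r\<close>, so the number of such words bounds all balls of radius \<open>r\<close> at
  once.\<close>

lemma wdist_ball:
  "\<exists>N. \<forall>x\<in>carrier G. finite {y \<in> carrier G. wdist x y \<le> r} \<and> card {y \<in> carrier G. wdist x y \<le> r} \<le> N"
proof -
  define W where "W = {ws. set ws \<subseteq> letters \<and> length ws \<le> r}"
  have W: "finite W" unfolding W_def using finite_generators by (intro finite_lists_length_le) auto
  have "{y \<in> carrier G. wdist x y \<le> r} \<subseteq> (\<lambda>ws. x \<otimes> word ws) ` W" if x: "x \<in> carrier G" for x
  proof
    fix y assume "y \<in> {y \<in> carrier G. wdist x y \<le> r}"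
    then have y: "y \<in> carrier G" "wdist x y \<le> r" by auto
    then obtain ws where ws: "length ws = wdist x y" "set ws \<subseteq> letters" "word ws = inv x \<otimes> y"
      using geodesic_word[of "inv x \<otimes> y"] x unfolding wdist_def by auto
    then have "y = x \<otimes> word ws" using mult_inv_cancel[OF x y(1)] by simp
    moreover have "ws \<in> W" using ws y(2) by (simp add: W_def)
    ultimately show "y \<in> (\<lambda>ws. x \<otimes> word ws) ` W" by (rule image_eqI)
  qed
  then show ?thesis
    using W by (intro exI[of _ "card W"]) (meson card_image_le card_mono finite_imageI finite_subset order_trans)
qed

lemma carrier_countable: "countable (carrier G)"
proof -
  have "carrier G \<subseteq> word ` lists letters"
    using word_exists by (force simp: in_lists_conv_set)
  moreover have "countable (lists letters)"
    using finite_generators by (intro countable_lists countable_finite) auto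
  ultimately show ?thesis by (rule countable_subset[OF _ countable_image])
qed

text \<open>Each letter of one generating set is rewritten as a word in the other, at a cost of at
  most \<open>C\<close>. The \<open>Suc\<close> keeps \<open>C\<close> positive even if there are no
  letters, since such a constant is divided by later.\<close>

lemma len_le_mult_len:
  assumes "generated_group G T"
  shows "\<exists>C>0. \<forall>g\<in>carrier G. word_length G T g \<le> C * len g"
proof -
  interpret T: generated_group G T by fact
  define C where "C = Suc (\<Sum>s\<in>letters. T.len s)"
  have fin: "finite letters" using finite_generators by auto
  have "T.len (word ws) \<le> C * length ws" if "set ws \<subseteq> letters" for ws
    using that
  proof (induction ws)
    case Nil
    then show ?case by (simp add: T.len_eq_0)
  next
    case (Cons a ws)
    have a: "a \<in> letters" using Cons.prems by simp
    then have "T.len a \<le> C" unfolding C_def using fin member_le_sum[of a letters T.len] by simp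
    moreover have "T.len (a \<otimes> word ws) \<le> T.len a + T.len (word ws)"
      using T.len_mult a letters_in word_in[of ws] Cons.prems by auto
    ultimately show ?case using Cons by simp
  qed
  then have "T.len g \<le> C * len g" if "g \<in> carrier G" for g
    using geodesic_word[OF that] by metis
  then show ?thesis by (intro exI[of _ C]) (simp add: C_def)
qed

lemma realized_cayley_graph:
  assumes "Metric_space (realization (carrier G) (cayley_edge G S)) (path_metric (carrier G) (cayley_edge G S))"
  shows "realized_graph (carrier G) wdist (cayley_edge G S)"
  using assms cayley_edge_iff graph_metric_axioms
  by (simp add: realized_graph_def realized_graph_axioms_def)

end

lemma (in generated_group) rooted_hyperbolic_exists:
  assumes "hyperbolic_space (realization (carrier G) (cayley_edge G S)) (path_metric (carrier G) (cayley_edge G S))"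
  shows "\<exists>(b :: 'a \<Rightarrow> ell2) par \<Delta> N. rooted_hyperbolic (carrier G) b wdist \<one> par \<Delta> N"
proof -
  let ?R = "realization (carrier G) (cayley_edge G S)" and ?p = "path_metric (carrier G) (cayley_edge G S)"
  obtain \<delta> where \<delta>: "\<delta> > 0" "\<And>A B C. geodesic_triangle ?R ?p A B C \<Longrightarrow> thin_triangle ?R ?p \<delta> A B C"
    using assms unfolding hyperbolic_space_def by blast
  interpret realized_graph "carrier G" wdist "cayley_edge G S"
    using assms by (intro realized_cayley_graph) (simp add: hyperbolic_space_def geodesic_metric_space_def)
  obtain par where par: "spanning_tree (carrier G) wdist \<one> par"
    using spanning_tree_exists[OF one_closed] by blast
  interpret spanning_tree "carrier G" wdist \<one> par by (rule par)
  obtain b :: "'a \<Rightarrow> ell2" where b: "orthonormal_family (carrier G) b"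
    using orthonormal_family_ell2[OF carrier_countable] by blast
  interpret orthonormal_family "carrier G" b by (rule b)
  \<comment> \<open>The bound of \<open>geodesics_fellow_travel\<close>, rounded up. It also exceeds
    \<open>\<delta> + 1\<close>, so \<open>wdist x y + \<Delta> \<le> r\<close> implies the length
    hypothesis of that lemma.\<close>
  define \<Delta> where "\<Delta> = nat \<lceil>2 * (\<delta> + 1)\<rceil>"
  have \<Delta>: "2 * (\<delta> + 1) \<le> real \<Delta>" unfolding \<Delta>_def by linarith
  obtain N where N: "\<forall>x\<in>carrier G. finite {y \<in> carrier G. wdist x y \<le> 2 * \<Delta>} \<and>
      card {y \<in> carrier G. wdist x y \<le> 2 * \<Delta>} \<le> N"
    using wdist_ball by blast
  have "rooted_hyperbolic (carrier G) b wdist \<one> par \<Delta> N"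
  proof
    fix x y i r s
    assume x: "x \<in> carrier G" and y: "y \<in> carrier G" and lx: "lev x = i + r" and ly: "lev y = i + s"
      and le: "wdist x y + \<Delta> \<le> r"
    have "real (wdist ((\<lambda>i. anc (lev x - i) x) i) ((\<lambda>i. anc (lev y - i) y) i)) \<le> 2 * (\<delta> + 1)"
    proof (rule geodesics_fellow_travel[OF \<delta>(2) anc_geod[OF x] anc_geod[OF y]])
      show "anc (lev x - 0) x = anc (lev y - 0) y"
        using anc_root[OF x, of "lev x"] anc_root[OF y, of "lev y"] by simp
      show "real (i + wdist (anc (lev x - lev x) x) (anc (lev y - lev y) y)) + \<delta> + 1 \<le> real (lev x)"
        using le \<Delta> \<delta>(1) lx by simp
    qed (use ly \<delta> in auto)
    then have "real (wdist (anc r x) (anc s y)) \<le> real \<Delta>" using \<Delta> lx ly by simp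
    then show "wdist (anc r x) (anc s y) \<le> \<Delta>" by simp
  qed (use N \<Delta> \<delta>(1) in auto)
  then show ?thesis by blast
qed

section \<open>Compression of hyperbolic groups\<close>

lemma generated_groupI: "group G \<Longrightarrow> finite_generating_set G S \<Longrightarrow> generated_group G S"
  by (simp add: generated_group_def generated_group_axioms_def finite_generating_set_def)

text \<open>Hyperbolicity is given for some generating set \<open>T\<close>, the compression is
  taken for \<open>S\<close>; the two word metrics agree up to constant factors, which affect only
  the constants of the estimates. The exponent is \<open>\<beta> + 1 / 2\<close> with
  \<open>\<beta> \<ge> 0\<close>, hence the restriction to
  \<open>\<alpha> \<ge> 1 / 2\<close>.\<close>

lemma hyperbolic_group_compression_exponent:
  assumes "hyperbolic_group G" "finite_generating_set G S" "1 / 2 \<le> \<alpha>" "\<alpha> < 1"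
  shows "compression_exponent (carrier G) (word_metric G S) TYPE(ell2) \<alpha>"
proof -
  obtain T where T: "group G" "finite_generating_set G T"
    "hyperbolic_space (realization (carrier G) (cayley_edge G T)) (path_metric (carrier G) (cayley_edge G T))"
    using assms(1) unfolding hyperbolic_group_def by blast
  interpret S: generated_group G S using T(1) assms(2) by (rule generated_groupI)
  interpret T: generated_group G T using T(1,2) by (rule generated_groupI)
  obtain b :: "'a \<Rightarrow> ell2" and par \<Delta> N
    where "rooted_hyperbolic (carrier G) b T.wdist \<one>\<^bsub>G\<^esub> par \<Delta> N"
    using T.rooted_hyperbolic_exists[OF T(3)] by blast
  then interpret H: rooted_hyperbolic "carrier G" b T.wdist "\<one>\<^bsub>G\<^esub>" par \<Delta> N .
  define \<beta> where "\<beta> = \<alpha> - 1 / 2"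
  have \<beta>: "0 \<le> \<beta>" "\<beta> < 1 / 2" "\<beta> + 1 / 2 = \<alpha>" using assms by (auto simp: \<beta>_def)
  obtain L where L: "L \<ge> 0" "\<forall>x\<in>carrier G. \<forall>y\<in>carrier G. dist (H.emb \<beta> x) (H.emb \<beta> y) \<le> L * real (T.wdist x y)"
    using H.emb_lipschitz[OF \<beta>(1,2)] by blast
  obtain c M where c: "c > 0" "M \<ge> 0" "\<forall>x\<in>carrier G. \<forall>y\<in>carrier G. real (T.wdist x y) \<ge> M \<longrightarrow>
      c * real (T.wdist x y) powr \<alpha> \<le> dist (H.emb \<beta> x) (H.emb \<beta> y)"
    using H.emb_dist_ge[OF \<beta>(1)] unfolding \<beta>(3) by blast
  obtain A where A: "A > 0" "\<forall>g\<in>carrier G. T.len g \<le> A * S.len g"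
    using S.len_le_mult_len[OF T.generated_group_axioms] by blast
  obtain B where B: "B > 0" "\<forall>g\<in>carrier G. S.len g \<le> B * T.len g"
    using T.len_le_mult_len[OF S.generated_group_axioms] by blast
  have TS: "real (T.wdist x y) \<le> real A * word_metric G S x y"
    and ST: "word_metric G S x y / real B \<le> real (T.wdist x y)"
    if "x \<in> carrier G" "y \<in> carrier G" for x y
  proof -
    have g: "inv\<^bsub>G\<^esub> x \<otimes>\<^bsub>G\<^esub> y \<in> carrier G" using that by simp
    have "real (T.wdist x y) \<le> real (A * S.len (inv\<^bsub>G\<^esub> x \<otimes>\<^bsub>G\<^esub> y))"
      unfolding T.wdist_def of_nat_le_iff using A(2) g by blast
    then show "real (T.wdist x y) \<le> real A * word_metric G S x y"
      by (simp add: word_metric_def)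
    have "word_metric G S x y \<le> real (B * T.wdist x y)"
      unfolding T.wdist_def word_metric_def of_nat_le_iff using B(2) g by blast
    then show "word_metric G S x y / real B \<le> real (T.wdist x y)"
      using B(1) by (simp add: field_simps)
  qed
  show ?thesis
  proof (rule compression_exponentI)
    show "0 < \<alpha>" "0 \<le> L * real A" "0 < c * (1 / real B) powr \<alpha>" "0 \<le> M * real B"
      using assms L c A B by auto
    fix x y assume xy: "x \<in> carrier G" "y \<in> carrier G"
    have "dist (H.emb \<beta> x) (H.emb \<beta> y) \<le> L * real (T.wdist x y)" using L(2) xy by blast
    also have "\<dots> \<le> L * (real A * word_metric G S x y)" using TS[OF xy] L(1) by (rule mult_left_mono)
    finally show "dist (H.emb \<beta> x) (H.emb \<beta> y) \<le> L * real A * word_metric G S x y" by (simp add: mult.assoc)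
    assume "M * real B \<le> word_metric G S x y"
    then have "M \<le> word_metric G S x y / real B" using B(1) by (simp add: field_simps)
    then have "M \<le> real (T.wdist x y)" using ST[OF xy] by simp
    then have "c * real (T.wdist x y) powr \<alpha> \<le> dist (H.emb \<beta> x) (H.emb \<beta> y)" using c(3) xy by blast
    moreover have "c * (word_metric G S x y / real B) powr \<alpha> \<le> c * real (T.wdist x y) powr \<alpha>"
      using ST[OF xy] c(1) assms(3) by (intro mult_left_mono powr_mono2) (auto simp: word_metric_def)
    moreover have "(word_metric G S x y / real B) powr \<alpha> = (1 / real B) powr \<alpha> * word_metric G S x y powr \<alpha>"
      using B(1) by (simp add: word_metric_def powr_divide)
    ultimately show "c * (1 / real B) powr \<alpha> * word_metric G S x y powr \<alpha> \<le> dist (H.emb \<beta> x) (H.emb \<beta> y)"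
      by (simp add: mult.assoc)
  qed
qed

theorem mainTheorem3:
  fixes G :: "('a, 'b) monoid_scheme" and S :: "'a set"
  assumes "hyperbolic_group G"
    and "finite_generating_set G S"
  shows "group_hilbert_compression G S = 1"
proof (rule antisym)
  show "group_hilbert_compression G S \<le> 1"
    unfolding group_hilbert_compression_def hilbert_compression_def
    by (rule Sup_least) (auto simp: ennreal_le_1)
  show "1 \<le> group_hilbert_compression G S"
  \<comment> \<open>The exponent 1 itself is not constructed; it suffices that the supremum
    dominates every \<open>z < 1\<close>.\<close>
  proof (rule dense_le)
    fix z :: ennreal assume z: "z < 1"
    define r where "r = enn2real z"
    have zr: "z = ennreal r" "r < 1" "0 \<le> r"
      using z by (cases z; simp add: r_def ennreal_less_one_iff)+
    \<comment> \<open>Smaller values are raised to 1/2, where the available exponents begin.\<close>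
    define \<alpha> where "\<alpha> = max r (1 / 2)"
    have "compression_exponent (carrier G) (word_metric G S) TYPE(ell2) \<alpha>"
      by (rule hyperbolic_group_compression_exponent[OF assms]) (use zr in \<open>auto simp: \<alpha>_def\<close>)
    then have "ennreal \<alpha> \<le> group_hilbert_compression G S"
      unfolding group_hilbert_compression_def hilbert_compression_def
      using zr by (intro Sup_upper CollectI exI[of _ \<alpha>]) (auto simp: \<alpha>_def)
    moreover have "z \<le> ennreal \<alpha>" unfolding zr(1) \<alpha>_def by (intro ennreal_leI) simp
    ultimately show "z \<le> group_hilbert_compression G S" by (rule order_trans[rotated])
  qed
qed

end
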